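(* Let $n\ge 1$. For all $k \ge 0$, the number $f_k(\mathcal{O}(\mathcal{C}_{2n}))$ of $k$-dimensional faces of the order polytope of the crown poset $\mathcal{C}_{2n}$ is $$f_k(\mathcal{O}(\mathcal{C}_{2n})) = \delta_k + \sum_{i=2}^{2n} \sum_{m=1}^{\lfloor i/2\rfloor} \frac{2n}{i}\binom{i}{2m}\binom{n+m-1}{i-1}\binom{2m}{i-k},$$ where $\delta_0=2$, $\delta_1=1$, and $\delta_k=0$ for $k>1$.
   Context: The crown poset $\mathcal{C}_{2n}$ is the poset on $[2n]=\{1,\dots,2n\}$ with cover relations $1\prec 2\succ 3\prec 4\succ\cdots\succ 2n-1\prec 2n\succ 1$ (odd elements are minimal, even elements are maximal, each element is comparable exactly to its cyclic neighbours; for $n=1$ it is the chain $1\prec 2$). The order polytope of a poset $P=([d],\preceq)$ is $\mathcal{O}(P)=\{x\in[0,1]^d : x_i\le x_j \text{ whenever } i\preceq j\}$. The whole polytope is counted as a face. Convention: $\binom{a}{b}=0$ if $b<0$ (and, as usual, if $b>a\ge 0$). *)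

theory Defs
  imports "HOL-Analysis.Analysis"
begin

text \<open>
  For \<open>n = 1\<close> the two neighbours of \<open>1\<close> coincide, and the crown is the chain \<open>1 \<prec> 2\<close>.
\<close>

definition crown_covers :: "nat \<Rightarrow> (nat \<times> nat) set" where
  "crown_covers n = {(i, j). i \<in> {1..2*n} \<and> odd i \<and>
      (j = i + 1 \<or> j = (if i = 1 then 2*n else i - 1))}"

definition crown_poset :: "nat \<Rightarrow> (nat \<times> nat) set" where
  "crown_poset n = Id_on {1..2*n} \<union> (crown_covers n)\<^sup>+"

lemma crown_coversD: "(i, j) \<in> crown_covers n \<Longrightarrow> odd i \<and> even j \<and> i \<in> {1..2*n} \<and> j \<in> {1..2*n}"
proof -
  assume ij: "(i, j) \<in> crown_covers n"
  have i: "odd i" "1 \<le> i" "i \<le> 2*n" and j: "j = i + 1 \<or> j = (if i = 1 then 2*n else i - 1)"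
    using ij by (simp_all add: crown_covers_def)
  have "i \<noteq> 2*n"
    using i(1) by auto
  then show ?thesis
    using i j by (cases "i = 1") auto
qed

lemma trans_crown_covers: "trans (crown_covers n)"
  by (rule transI) (auto dest!: crown_coversD)

lemma crown_poset_partial_order: "partial_order_on {1..2*n} (crown_poset n)"
proof -
  have eq: "crown_poset n = Id_on {1..2*n} \<union> crown_covers n"
    by (simp add: crown_poset_def trans_crown_covers)
  have sub: "crown_poset n \<subseteq> {1..2*n} \<times> {1..2*n}"
    unfolding eq by (auto dest: crown_coversD)
  moreover have "refl_on {1..2*n} (crown_poset n)"
    unfolding eq by (auto intro: refl_onI)
  moreover have "trans (crown_poset n)"
  proof (rule transI)
    fix i j k assume ij: "(i, j) \<in> crown_poset n" and jk: "(j, k) \<in> crown_poset n"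
    have "i = j \<or> j = k"
      using ij jk crown_coversD[of i j n] crown_coversD[of j k n] unfolding eq by auto
    then show "(i, k) \<in> crown_poset n"
      using ij jk by auto
  qed
  moreover have "antisym (crown_poset n)"
  proof (rule antisymI)
    fix i j assume "(i, j) \<in> crown_poset n" "(j, i) \<in> crown_poset n"
    then show "i = j"
      using crown_coversD[of i j n] crown_coversD[of j i n] unfolding eq by auto
  qed
  ultimately show ?thesis
    by (simp add: partial_order_on_def preorder_on_def)
qed

text \<open>
  The order relation \<open>r\<close> lives on the coordinate indices of the ambient space \<open>real ^ 'd\<close>.
  A poset \<open>s\<close> on the numbers \<open>{1..d}\<close> with \<open>d = CARD('d)\<close> is transported to \<open>'d\<close> along a
  labelling \<open>lab :: 'd \<Rightarrow> nat\<close>, a bijection onto \<open>{1..d}\<close>, as \<open>inv_image s lab\<close>;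
  \<open>x $ a\<close> is then the coordinate with number \<open>lab a\<close>.
\<close>

definition order_polytope :: "('d \<times> 'd) set \<Rightarrow> (real ^ 'd) set" where
  "order_polytope r =
     {x. (\<forall>i. 0 \<le> x $ i \<and> x $ i \<le> 1) \<and> (\<forall>i j. (i, j) \<in> r \<longrightarrow> x $ i \<le> x $ j)}"

text \<open>
  \<open>face_of\<close> admits both the whole set and the empty set as faces. The empty face has
  \<open>aff_dim\<close> equal to \<open>-1\<close>, so it is never counted here.
\<close>

definition face_number :: "nat \<Rightarrow> (real ^ 'd) set \<Rightarrow> nat" where
  "face_number k P = card {F. F face_of P \<and> aff_dim F = int k}"

end

theory Submission
  imports Defs
begin

text \<open>
  A face of a polyhedron is determined by the constraints that are tight on its relative interior,
  so the faces are counted by counting the sets of constraints that can be tight at a point, and the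
  dimension of a face is that of the space of directions along which all these constraints stay
  tight.

  A point of the order polytope is a labelling \<open>y\<close> of the vertices \<open>1, \<dots>, 2 * n\<close> of a cycle. Edge \<open>v\<close>
  joins \<open>v\<close> to its cyclic successor; the value may only go up along it if \<open>v\<close> is odd and only down if
  \<open>v\<close> is even. Call \<open>v\<close> a cut if the value really changes along edge \<open>v\<close>. If there is no cut, then \<open>y\<close>
  is constant, and the constants \<open>0\<close>, \<open>1\<close> and those in between give the two vertices and the one edge
  in the term \<open>\<delta>\<^sub>k\<close>. Otherwise the set \<open>S\<close> of cuts divides the cycle into \<open>card S\<close> arcs on which \<open>y\<close> is
  constant. The remaining information about tight constraints is which arcs have the value \<open>0\<close> or \<open>1\<close>.
  An arc of value \<open>0\<close> lies strictly below both neighbouring arcs, so it begins and ends with an odd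
  vertex; an arc of value \<open>1\<close> begins and ends with an even one. Thus an arc pinned to \<open>0\<close> or \<open>1\<close> has
  odd length, and the parity of its ends tells which of the two values it has. As the total change
  around the cycle is zero, \<open>S\<close> has an odd and an even element, equivalently some arc has odd length.

  Conversely, every \<open>S\<close> containing both parities and every set \<open>Z\<close> of arcs of odd length occurs
  (\<open>exists_labelling\<close>): let the value rise and fall along the cuts by amounts that add up to zero,
  squeeze everything into the open unit interval, and then move the arcs in \<open>Z\<close> to \<open>0\<close> or \<open>1\<close>. The
  values of the other arcs are free up to inequalities that are strict, so the dimension of the face is
  \<open>card S - card Z\<close>. Hence a set of \<open>i\<close> cuts with \<open>2 * m\<close> odd arcs accounts for
  \<open>(2*m) choose (i - k)\<close> faces of dimension \<open>k\<close>.

  It remains to count these sets of cuts. An arc is odd exactly if the cuts at its two ends differ in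
  parity, so the number of odd arcs is the number of parity changes in the cyclic sequence of cuts.
  The number of sets with a given number of parity changes in their linear order satisfies Pascal's
  recurrence (\<open>card_sets_with_changes\<close>), and closing up the cycle adds at most one change
  (\<open>card_cyclic_changes\<close>), which gives the remaining factor of the summand.
\<close>

section \<open>Faces of a polyhedron and tight constraints\<close>

definition polyhedron_of :: "('a::euclidean_space \<times> real) set \<Rightarrow> 'a set" where
  "polyhedron_of H = {x. \<forall>h\<in>H. fst h \<bullet> x \<le> snd h}"

definition tight :: "('a::euclidean_space \<times> real) set \<Rightarrow> 'a \<Rightarrow> ('a \<times> real) set" where
  "tight H x = {h\<in>H. fst h \<bullet> x = snd h}"

definition tight_face :: "('a::euclidean_space \<times> real) set \<Rightarrow> 'a \<Rightarrow> 'a set" where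
  "tight_face H x = {y \<in> polyhedron_of H. tight H x \<subseteq> tight H y}"

definition tight_directions :: "('a::euclidean_space \<times> real) set \<Rightarrow> 'a \<Rightarrow> 'a set" where
  "tight_directions H x = {d. \<forall>h\<in>tight H x. fst h \<bullet> d = 0}"

lemma convex_polyhedron_of: "convex (polyhedron_of H)"
proof -
  have "polyhedron_of H = (\<Inter>h\<in>H. {x. fst h \<bullet> x \<le> snd h})"
    by (auto simp: polyhedron_of_def)
  then show ?thesis
    by (simp add: convex_INT convex_halfspace_le)
qed

text \<open>
  If a convex combination with positive weights of two feasible points makes a constraint tight, then
  the constraint is tight at both points.
\<close>

lemma tight_face_face_of: "tight_face H x face_of polyhedron_of H"
  unfolding face_of_def
proof (intro conjI ballI impI)
  show "tight_face H x \<subseteq> polyhedron_of H"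
    by (auto simp: tight_face_def)
  have "tight_face H x = polyhedron_of H \<inter> (\<Inter>h\<in>tight H x. {y. fst h \<bullet> y = snd h})"
    by (auto simp: tight_face_def tight_def)
  then show "convex (tight_face H x)"
    by (simp add: convex_Int convex_INT convex_hyperplane convex_polyhedron_of)
next
  fix p q y assume pq: "p \<in> polyhedron_of H" "q \<in> polyhedron_of H"
    and y: "y \<in> tight_face H x" "y \<in> open_segment p q"
  obtain u where u: "0 < u" "u < 1" and yu: "y = (1 - u) *\<^sub>R p + u *\<^sub>R q"
    using y(2) by (auto simp: in_segment)
  have "fst h \<bullet> p = snd h \<and> fst h \<bullet> q = snd h" if h: "h \<in> tight H x" for h
  proof -
    have hH: "h \<in> H" using h by (simp add: tight_def)
    have le: "0 \<le> snd h - fst h \<bullet> p" "0 \<le> snd h - fst h \<bullet> q"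
      using pq hH by (auto simp: polyhedron_of_def)
    have "fst h \<bullet> y = snd h"
      using y(1) h by (auto simp: tight_face_def tight_def)
    then have "(1 - u) * (snd h - fst h \<bullet> p) + u * (snd h - fst h \<bullet> q) = 0"
      unfolding yu by (simp add: inner_add_right algebra_simps)
    then show ?thesis
      using u le by (simp add: add_nonneg_eq_0_iff)
  qed
  then show "p \<in> tight_face H x" "q \<in> tight_face H x"
    using pq by (auto simp: tight_face_def tight_def)
qed

text \<open>
  Near \<open>x\<close> the constraints that are not tight at \<open>x\<close> hold automatically, since there are only finitely
  many of them. So the face agrees near \<open>x\<close> with the affine space \<open>x + tight_directions H x\<close>, which is
  then its affine hull.
\<close>

lemma
  assumes "finite H" "x \<in> polyhedron_of H"
  shows rel_interior_tight_face: "x \<in> rel_interior (tight_face H x)"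
    and aff_dim_tight_face: "aff_dim (tight_face H x) = int (dim (tight_directions H x))"
proof -
  define A where "A = (+) x ` tight_directions H x"
  have A: "A = {y. \<forall>h\<in>tight H x. fst h \<bullet> y = snd h}"
  proof -
    have "y \<in> A \<longleftrightarrow> y - x \<in> tight_directions H x" for y
      unfolding A_def by (auto simp: image_iff algebra_simps) (metis add_diff_cancel_left' diff_add_cancel add.commute)
    then show ?thesis
      by (auto simp: tight_directions_def tight_def inner_diff_right)
  qed
  have sub: "subspace (tight_directions H x)"
    by (auto simp: tight_directions_def subspace_def inner_add_right)
  have affA: "affine A"
    unfolding A_def using sub affine_translation subspace_imp_affine by blast
  have FA: "tight_face H x \<subseteq> A"
    by (auto simp: A tight_face_def tight_def)
  define U where "U = (\<Inter>h\<in>H - tight H x. {y. fst h \<bullet> y < snd h})"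
  have U: "open U"
    unfolding U_def using assms(1) by (intro open_INT) (auto intro: open_halfspace_lt)
  have xU: "x \<in> U"
    using assms(2) by (fastforce simp: U_def tight_def polyhedron_of_def)
  have AU: "A \<inter> U \<subseteq> tight_face H x"
    by (force simp: A U_def tight_face_def polyhedron_of_def tight_def intro: less_imp_le)
  have xF: "x \<in> tight_face H x"
    using assms(2) by (simp add: tight_face_def)
  have hull: "affine hull (tight_face H x) \<subseteq> A"
    using FA affA by (rule hull_minimal)
  show "x \<in> rel_interior (tight_face H x)"
    unfolding mem_rel_interior
    using U xU xF AU hull by blast
  have "aff_dim A \<le> aff_dim (A \<inter> U)"
    using aff_dim_convex_Int_open[OF affine_imp_convex[OF affA] U] xU xF FA by force
  then have "aff_dim (tight_face H x) = aff_dim A"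
    using aff_dim_subset[OF AU] aff_dim_subset[OF FA] by linarith
  then show "aff_dim (tight_face H x) = int (dim (tight_directions H x))"
    using sub by (simp add: A_def aff_dim_translation_eq aff_dim_subspace)
qed

text \<open>
  The face is recovered from any point in its relative interior, because two faces with a
  common relative interior point coincide.
\<close>

lemma face_eq_tight_face:
  assumes "finite H" "F face_of polyhedron_of H" "F \<noteq> {}"
  shows "\<exists>x\<in>polyhedron_of H. F = tight_face H x"
proof -
  have "convex F" using assms(2) by (rule face_of_imp_convex)
  then obtain x where x: "x \<in> rel_interior F"
    using assms(3) rel_interior_eq_empty by blast
  then have xP: "x \<in> polyhedron_of H"
    using assms(2) rel_interior_subset face_of_imp_subset by blast
  then have "F = tight_face H x"
    using face_of_eq[OF assms(2) tight_face_face_of] rel_interior_tight_face[OF assms(1) xP] x by blast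
  then show ?thesis using xP by blast
qed

text \<open>
  Allows one invariant of a point to be replaced by another that separates the same points.
\<close>

lemma card_image_cong_kernel:
  assumes "\<And>x y. x \<in> A \<Longrightarrow> y \<in> A \<Longrightarrow> f x = f y \<longleftrightarrow> g x = g y"
  shows "card (f ` A) = card (g ` A)"
proof -
  have "bij_betw (\<lambda>b. g (inv_into A f b)) (f ` A) (g ` A)"
  proof (rule bij_betw_imageI)
    have *: "g (inv_into A f (f x)) = g x" if "x \<in> A" for x
      using that assms[of "inv_into A f (f x)" x] by (simp add: inv_into_into f_inv_into_f)
    then show "(\<lambda>b. g (inv_into A f b)) ` f ` A = g ` A"
      by (force simp: image_image)
    show "inj_on (\<lambda>b. g (inv_into A f b)) (f ` A)"
      using * assms by (auto simp: inj_on_def)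
  qed
  then show ?thesis by (rule bij_betw_same_card)
qed

lemma face_number_polyhedron_of:
  fixes H :: "((real ^ 'd) \<times> real) set"
  assumes "finite H"
  shows "face_number k (polyhedron_of H) =
    card (tight H ` {x \<in> polyhedron_of H. dim (tight_directions H x) = k})"
proof -
  let ?X = "{x \<in> polyhedron_of H. dim (tight_directions H x) = k}"
  have "{F. F face_of polyhedron_of H \<and> aff_dim F = int k} = tight_face H ` ?X"
  proof (intro equalityI subsetI)
    fix F assume F: "F \<in> {F. F face_of polyhedron_of H \<and> aff_dim F = int k}"
    then have "F \<noteq> {}" by auto
    then obtain x where x: "x \<in> polyhedron_of H" "F = tight_face H x"
      using face_eq_tight_face assms F by blast
    then show "F \<in> tight_face H ` ?X"
      using F aff_dim_tight_face[OF assms x(1)] by auto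
  qed (use assms tight_face_face_of aff_dim_tight_face in auto)
  moreover have "card (tight_face H ` ?X) = card (tight H ` ?X)"
  proof (rule card_image_cong_kernel)
    fix x y assume "x \<in> ?X" "y \<in> ?X"
    then have "x \<in> tight_face H x" "y \<in> tight_face H y"
      by (auto simp: tight_face_def)
    then show "tight_face H x = tight_face H y \<longleftrightarrow> tight H x = tight H y"
      by (auto simp: tight_face_def)
  qed
  ultimately show ?thesis
    by (simp add: face_number_def)
qed

text \<open>
  The indicator vectors of the fibres of \<open>c\<close> over \<open>range c - K\<close> form an orthogonal basis.
\<close>

lemma dim_block_constant:
  fixes c :: "'d::finite \<Rightarrow> 'b"
  shows "dim {y :: real ^ 'd. (\<forall>i. c i \<in> K \<longrightarrow> y $ i = 0) \<and> (\<forall>i j. c i = c j \<longrightarrow> y $ i = y $ j)}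
    = card (range c - K)"
proof -
  let ?L = "{y :: real ^ 'd. (\<forall>i. c i \<in> K \<longrightarrow> y $ i = 0) \<and> (\<forall>i j. c i = c j \<longrightarrow> y $ i = y $ j)}"
  define e :: "'b \<Rightarrow> real ^ 'd" where "e b = (\<chi> i. if c i = b then 1 else 0)" for b
  let ?R = "range c - K"
  have inner: "e b \<bullet> e b' = 0" if "b \<noteq> b'" for b b'
    using that by (auto simp: e_def inner_vec_def intro!: sum.neutral)
  have nz: "e b \<noteq> 0" if "b \<in> ?R" for b
    using that by (auto simp: e_def vec_eq_iff)
  have inj: "inj_on e ?R"
    by (rule inj_onI) (use inner nz in force)
  have "independent (e ` ?R)"
    by (rule pairwise_orthogonal_independent)
      (use inner nz in \<open>auto simp: pairwise_def orthogonal_def\<close>, metis)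
  moreover have "e ` ?R \<subseteq> ?L"
    by (auto simp: e_def)
  moreover have "?L \<subseteq> span (e ` ?R)"
  proof
    fix y assume y: "y \<in> ?L"
    define z where "z b = y $ (inv c b)" for b
    have "y = (\<Sum>b\<in>?R. z b *\<^sub>R e b)"
    proof (rule vec_eq_iff[THEN iffD2], rule allI)
      fix i
      have "(\<Sum>b\<in>?R. z b *\<^sub>R e b) $ i = (\<Sum>b\<in>?R. if b = c i then z b else 0)"
        unfolding sum_component by (rule sum.cong) (auto simp: e_def)
      also have "\<dots> = (if c i \<in> K then 0 else z (c i))"
        by simp
      also have "\<dots> = y $ i"
      proof -
        have "c (inv c (c i)) = c i"
          by (simp add: f_inv_into_f)
        then have "y $ (inv c (c i)) = y $ i" "c i \<in> K \<Longrightarrow> y $ i = 0"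
          using y by blast+
        then show ?thesis
          by (simp add: z_def)
      qed
      finally show "y $ i = (\<Sum>b\<in>?R. z b *\<^sub>R e b) $ i" ..
    qed
    then show "y \<in> span (e ` ?R)"
      by (metis (no_types, lifting) imageI span_base span_scale span_sum)
  qed
  ultimately have "dim ?L = card (e ` ?R)"
    by (metis (no_types, lifting) dim_unique)
  then show ?thesis
    using card_image[OF inj] by simp
qed

section \<open>Sets of integers with a given number of parity changes\<close>

definition parity_changes :: "nat set \<Rightarrow> nat set" where
  "parity_changes S = {t \<in> S - {Min S}. odd t \<noteq> odd (Max {s\<in>S. s < t})}"

lemma Min_Max_insert_above:
  fixes N :: "'a::linorder"
  assumes "finite S" "S \<noteq> {}" "\<And>s. s \<in> S \<Longrightarrow> s < N"
  shows "Min (insert N S) = Min S" "Max (insert N S) = N"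
proof -
  have "Min S \<in> S" using assms by simp
  then have "Min S \<le> N" using assms(3) by (blast intro: less_imp_le)
  then show "Min (insert N S) = Min S"
    using assms by (intro Min_eqI) auto
  show "Max (insert N S) = N"
    using assms by (intro Max_eqI) (auto intro: less_imp_le)
qed

lemma parity_changes_insert_Max:
  assumes "finite S" "S \<noteq> {}" "\<And>s. s \<in> S \<Longrightarrow> s < N"
  shows "parity_changes (insert N S) = parity_changes S \<union> (if odd (Max S) \<noteq> odd N then {N} else {})"
proof -
  have min: "Min (insert N S) = Min S"
    using assms by (rule Min_Max_insert_above)
  have below: "{s \<in> insert N S. s < t} = (if t = N then S else {s \<in> S. s < t})" if "t \<in> insert N S" for t
    using that assms(3) by (auto dest: order.strict_trans)
  have "N \<notin> S" using assms(3) by blast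
  moreover have "Min S \<in> S" using assms by simp
  ultimately show ?thesis
    unfolding parity_changes_def min
    using below by (auto split: if_splits)
qed

text \<open>
  The parity flips at each change between the least and the greatest element.
\<close>

lemma parity_Max_iff:
  assumes "finite S" "S \<noteq> {}"
  shows "odd (Max S) \<longleftrightarrow> (odd (Min S) \<longleftrightarrow> even (card (parity_changes S)))"
  using assms
proof (induction S rule: finite_linorder_max_induct)
  case (insert N S)
  show ?case
  proof (cases "S = {}")
    case False
    have "Max (insert N S) = N" "Min (insert N S) = Min S"
      using insert.hyps False by (simp_all add: Min_Max_insert_above)
    moreover have "N \<notin> parity_changes S" "finite (parity_changes S)"
      using insert.hyps by (auto simp: parity_changes_def)
    ultimately show ?thesis
      using insert False by (auto simp: parity_changes_insert_Max)
  qed (simp add: parity_changes_def)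
qed simp

text \<open>
  With the parity \<open>p\<close> of the least element fixed, the number \<open>c\<close> of changes determines the parity of
  the greatest element, so that the recursion on the upper bound \<open>N\<close> closes.
\<close>

definition sets_with_changes :: "nat \<Rightarrow> nat \<Rightarrow> nat \<Rightarrow> bool \<Rightarrow> nat set set" where
  "sets_with_changes N i c p =
     {S. S \<subseteq> {1..N} \<and> S \<noteq> {} \<and> card S = i \<and> card (parity_changes S) = c \<and> odd (Min S) = p}"

lemma finite_sets_with_changes: "finite (sets_with_changes N i c p)"
  by (rule finite_subset[of _ "Pow {1..N}"]) (auto simp: sets_with_changes_def)

text \<open>
  The new maximum \<open>Suc N\<close> of a set can follow either an element of its own parity or one of the
  opposite parity. The former preserves the number of changes and the latter raises it by one; in
  both cases \<open>Suc N\<close> must have the parity that \<open>p\<close> and the final number \<open>c\<close> of changes prescribe.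
\<close>

lemma sets_with_changes_Suc:
  assumes "i \<ge> 1"
  shows "sets_with_changes (Suc N) (Suc i) c p = sets_with_changes N (Suc i) c p \<union>
    insert (Suc N) ` (if odd (Suc N) = (p = even c) then
       sets_with_changes N i c p \<union> (if c = 0 then {} else sets_with_changes N i (c - 1) p) else {})"
    (is "?L = ?A \<union> insert (Suc N) ` ?B")
proof -
  have key: "insert (Suc N) T \<in> ?L \<longleftrightarrow> T \<in> ?B" if T: "T \<subseteq> {1..N}" for T
  proof (cases "T = {}")
    case False
    have fin: "finite T" using T finite_subset by blast
    have lt: "s < Suc N" if "s \<in> T" for s using T that by fastforce
    have min: "Min (insert (Suc N) T) = Min T"
      using fin False lt by (rule Min_Max_insert_above)
    have nin: "Suc N \<notin> T" "Suc N \<notin> parity_changes T" using lt by (auto simp: parity_changes_def)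
    have fc: "finite (parity_changes T)" using fin by (simp add: parity_changes_def)
    have sub: "insert (Suc N) T \<subseteq> {1..Suc N}" using T by auto
    have cc: "card (parity_changes (insert (Suc N) T)) =
        card (parity_changes T) + (if odd (Max T) \<noteq> odd (Suc N) then 1 else 0)"
      using fin False lt nin fc by (simp add: parity_changes_insert_Max)
    show ?thesis
      using parity_Max_iff[OF fin False] T sub False fin nin min cc
      by (auto simp: sets_with_changes_def)
  qed (use assms in \<open>auto simp: sets_with_changes_def\<close>)
  show ?thesis
  proof (intro equalityI subsetI)
    fix S assume S: "S \<in> ?L"
    show "S \<in> ?A \<union> insert (Suc N) ` ?B"
    proof (cases "Suc N \<in> S")
      case True
      then have eq: "insert (Suc N) (S - {Suc N}) = S" by (rule insert_Diff)
      moreover have "S - {Suc N} \<subseteq> {1..N}"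
        using S by (auto simp: sets_with_changes_def)
      ultimately have "S - {Suc N} \<in> ?B" using key[of "S - {Suc N}"] S by simp
      then have "insert (Suc N) (S - {Suc N}) \<in> insert (Suc N) ` ?B" by (rule imageI)
      then show ?thesis unfolding eq by (rule UnI2)
    next
      case False
      then have "S \<subseteq> {1..Suc N} \<longleftrightarrow> S \<subseteq> {1..N}"
        by (simp add: atLeastAtMostSuc_conv subset_insert)
      then show ?thesis
        using S by (simp add: sets_with_changes_def)
    qed
  next
    fix S assume S: "S \<in> ?A \<union> insert (Suc N) ` ?B"
    then consider "S \<in> ?A" | T where "T \<in> ?B" "S = insert (Suc N) T"
      by (elim UnE imageE)
    then show "S \<in> ?L"
    proof cases
      case 1 then show ?thesis by (auto simp: sets_with_changes_def)
    next
      case 2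
      then have "T \<subseteq> {1..N}" by (auto simp: sets_with_changes_def split: if_splits)
      then show ?thesis using key 2 by simp
    qed
  qed
qed

text \<open>
  There are \<open>i - 1 choose c\<close> ways to place the changes among the gaps between consecutive elements.
  This fixes the parity of every element; counting the sets with a given sequence of parities is
  the same as distributing the slack in steps of two, which gives the second factor. The proof is
  Pascal's rule along the recursion: the half in the upper index grows by one exactly if \<open>Suc N\<close> may
  be the new maximum.
\<close>

lemma card_sets_with_changes:
  assumes "i \<ge> 1"
  shows "card (sets_with_changes N i c p) =
    (i - 1 choose c) * ((N + c + (if p then 1 else 0)) div 2 choose i)"
  using assms
proof (induction N arbitrary: i c)
  case 0
  have "sets_with_changes 0 i c p = {}" by (auto simp: sets_with_changes_def)
  moreover have "(i - 1 choose c) * ((c + (if p then 1 else 0)) div 2 choose i) = 0"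
    using 0 by (cases "c \<le> i - 1") (auto intro!: binomial_eq_0)
  ultimately show ?case by simp
next
  case (Suc N)
  have disj: "Suc N \<notin> S" if "S \<in> sets_with_changes N j d q" for S j d q
    using that by (auto simp: sets_with_changes_def)
  have half: "(Suc N + c + (if p then 1 else 0)) div 2 =
     (N + c + (if p then 1 else 0)) div 2 + (if odd (Suc N) = (p = even c) then 1 else 0)"
    by (cases p; cases "even N"; cases "even c") (auto elim!: evenE oddE)
  have half': "(N + (c - 1) + (if p then 1 else 0)) div 2 = (N + c + (if p then 1 else 0)) div 2"
    if "odd (Suc N) = (p = even c)" "c \<noteq> 0"
    using that by (cases p; cases "even N"; cases "even c") (auto elim!: evenE oddE)
  define M where "M = (N + c + (if p then 1 else 0)) div 2"
  show ?case
  proof (cases "i = 1")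
    case True
    \<comment> \<open>The recursion starts from singletons: extending the empty set is not covered by it.\<close>
    have *: "sets_with_changes K 1 c p = (if c = 0 then (\<lambda>s. {s}) ` {s\<in>{1..K}. odd s = p} else {})" for K
    proof -
      have "parity_changes {s} = {}" for s by (auto simp: parity_changes_def)
      then show ?thesis
        by (auto simp: sets_with_changes_def card_1_singleton_iff)
    qed
    have "sets_with_changes (Suc N) 1 c p = sets_with_changes N 1 c p \<union>
       (if c = 0 \<and> odd (Suc N) = p then {{Suc N}} else {})"
      unfolding * by (auto simp: le_Suc_eq)
    moreover have "{Suc N} \<notin> sets_with_changes N 1 d p" for d
      using disj by blast
    ultimately have "card (sets_with_changes (Suc N) 1 c p) =
      card (sets_with_changes N 1 c p) + (if c = 0 \<and> odd (Suc N) = p then 1 else 0)"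
      using finite_sets_with_changes[of N 1] by simp
    then show ?thesis
      using Suc.IH[of 1 c] half True by (cases "c = 0") (auto)
  next
    case False
    then obtain j where j: "i = Suc j" "j \<ge> 1" using Suc.prems by (cases i) auto
    let ?b = "odd (Suc N) = (p = even c)"
    let ?C = "if c = 0 then {} else sets_with_changes N j (c - 1) p"
    have inj: "inj_on (insert (Suc N)) (sets_with_changes N j c p \<union> ?C)"
      using disj by (intro inj_onI) (auto split: if_splits, (metis insert_ident)+)
    have C: "card ?C = (if c = 0 then 0 else (j - 1 choose (c - 1)) * ((N + (c - 1) + (if p then 1 else 0)) div 2 choose j))"
      using Suc.IH[OF j(2), of "c - 1"] by simp
    have "sets_with_changes N j c p \<inter> ?C = {}"
      by (auto simp: sets_with_changes_def)
    then have u: "card (sets_with_changes N j c p \<union> ?C) = card (sets_with_changes N j c p) + card ?C"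
      by (intro card_Un_disjoint) (auto simp: finite_sets_with_changes)
    have "card (sets_with_changes (Suc N) i c p) = card (sets_with_changes N i c p) +
        card (insert (Suc N) ` (if ?b then sets_with_changes N j c p \<union> ?C else {}))"
      unfolding j(1) sets_with_changes_Suc[OF j(2)]
      by (intro card_Un_disjoint) (auto simp: finite_sets_with_changes dest: disj)
    also have "\<dots> = card (sets_with_changes N i c p) +
        (if ?b then card (sets_with_changes N j c p) + card ?C else 0)"
      by (cases ?b) (simp_all only: if_P if_not_P card_image[OF inj] u image_empty card.empty simp_thms)
    also have "\<dots> = (j choose c) * (M choose i) + (if ?b then (j - 1 choose c) * (M choose j) +
        (if c = 0 then 0 else (j - 1 choose (c - 1)) * (M choose j)) else 0)"
      using Suc.IH[OF Suc.prems, of c] Suc.IH[OF j(2), of c] half' j(1)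
      unfolding C M_def by simp
    also have "\<dots> = (j choose c) * (M choose i) + (if ?b then (j choose c) * (M choose j) else 0)"
      using j(2) by (cases j; cases c) (auto simp: algebra_simps)
    also have "\<dots> = (i - 1 choose c) * ((M + (if ?b then 1 else 0)) choose i)"
      using j(1) by (auto simp: algebra_simps)
    finally show ?thesis
      unfolding half M_def .
  qed
qed

text \<open>
  The last element of \<open>S\<close> strictly before \<open>v\<close> in the cyclic order. It serves as the name of the arc
  containing \<open>v\<close>: the arc named \<open>s\<close> begins right after the cut \<open>s\<close> and includes the next cut as its
  last vertex.
\<close>

definition previous_cut :: "nat set \<Rightarrow> nat \<Rightarrow> nat" where
  "previous_cut S v = (if \<exists>s\<in>S. s < v then Max {s\<in>S. s < v} else Max S)"

text \<open>
  As the cycle has even length, the arc that ends in \<open>t\<close> has odd length iff \<open>t\<close> is listed here.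
\<close>

definition cyclic_changes :: "nat set \<Rightarrow> nat set" where
  "cyclic_changes S = {t \<in> S. odd t \<noteq> odd (previous_cut S t)}"

lemma cyclic_changes_eq:
  assumes "finite S" "S \<noteq> {}"
  shows "cyclic_changes S = parity_changes S \<union> (if odd (Max S) \<noteq> odd (Min S) then {Min S} else {})"
proof -
  have "(\<exists>s\<in>S. s < t) \<longleftrightarrow> t \<noteq> Min S" if "t \<in> S" for t
    using assms that by (metis Min_in Min_le leD order_le_less)
  moreover have "Min S \<in> S" using assms by simp
  ultimately show ?thesis
    by (auto simp: cyclic_changes_def parity_changes_def previous_cut_def)
qed

text \<open>
  The wrap-around from the greatest to the least element is a change exactly if the number of the
  other changes is odd, so the cyclic number of changes is even.
\<close>

lemma card_cyclic_changes:
  assumes "finite S" "S \<noteq> {}"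
  shows "card (cyclic_changes S) = card (parity_changes S) + (if odd (card (parity_changes S)) then 1 else 0)"
proof -
  have "Min S \<notin> parity_changes S" "finite (parity_changes S)"
    using assms by (auto simp: parity_changes_def)
  then show ?thesis
    using parity_Max_iff[OF assms] by (auto simp: cyclic_changes_eq[OF assms])
qed

text \<open>
  A cyclic number \<open>2 * m\<close> of changes arises from \<open>2 * m\<close> or \<open>2 * m - 1\<close> linear ones. Adding up the
  linear counts for both numbers and both parities of the least element and expressing every binomial
  coefficient by \<open>i choose (2*m)\<close> and \<open>(n + m - 1) choose (i - 1)\<close> gives the product.
\<close>

lemma card_sets_with_cyclic_changes:
  assumes "i \<ge> 2" "m \<ge> 1" "i \<le> 2*n" "2*m \<le> i"
  shows "real (card {S. S \<subseteq> {1..2*n} \<and> card S = i \<and> card (cyclic_changes S) = 2*m}) =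
    real (2*n) / real i * real (i choose (2*m)) * real ((n + m - 1) choose (i - 1))"
proof -
  let ?G = "sets_with_changes (2*n) i"
  have "{S. S \<subseteq> {1..2*n} \<and> card S = i \<and> card (cyclic_changes S) = 2*m} =
     (?G (2*m) True \<union> ?G (2*m) False) \<union> (?G (2*m - 1) True \<union> ?G (2*m - 1) False)"
    (is "?X = ?Y")
  proof (intro set_eqI)
    fix S
    have "S \<in> ?X \<longleftrightarrow> S \<in> ?Y" if S: "S \<subseteq> {1..2*n}" "S \<noteq> {}"
    proof -
      have "card (cyclic_changes S) = 2*m \<longleftrightarrow>
          card (parity_changes S) = 2*m \<or> card (parity_changes S) = 2*m - 1"
        using card_cyclic_changes[of S] S finite_subset[OF S(1)] assms(2)
        by (cases "even (card (parity_changes S))") (simp; presburger)+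
      then show ?thesis
        using S by (auto simp: sets_with_changes_def)
    qed
    then show "S \<in> ?X \<longleftrightarrow> S \<in> ?Y"
      using assms by (cases "S = {}") (auto simp: sets_with_changes_def)
  qed
  also have "card ?Y = (card (?G (2*m) True) + card (?G (2*m) False)) +
      (card (?G (2*m - 1) True) + card (?G (2*m - 1) False))"
  proof -
    have "?G c True \<inter> ?G c False = {}"
      "(?G (2*m) True \<union> ?G (2*m) False) \<inter> (?G (2*m - 1) True \<union> ?G (2*m - 1) False) = {}" for c
      using assms(2) by (auto simp: sets_with_changes_def)
    then show ?thesis
      by (simp add: card_Un_disjoint finite_sets_with_changes)
  qed
  also have "\<dots> = 2 * ((i - 1 choose (2*m)) * (n + m choose i)) +
      (i - 1 choose (2*m - 1)) * ((n + m choose i) + (n + m - 1 choose i))"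
  proof -
    have "(2*n + 2*m + 1) div 2 = n + m" "(2*n + 2*m) div 2 = n + m"
      "(2*n + (2*m - 1) + 1) div 2 = n + m" "(2*n + (2*m - 1)) div 2 = n + m - 1"
      using assms(2) by auto
    then show ?thesis
      using assms(1) by (simp add: card_sets_with_changes algebra_simps)
  qed
  finally have card: "card ?X = 2 * ((i - 1 choose (2*m)) * (n + m choose i)) +
      (i - 1 choose (2*m - 1)) * ((n + m choose i) + (n + m - 1 choose i))" .
  define B where "B = real (i choose (2*m))"
  define D where "D = real (n + m - 1 choose (i - 1))"
  have i0: "real i \<noteq> 0" using assms by simp
  have 1: "real i * real (n + m choose i) = real (n + m) * D"
    using Suc_times_binomial_eq[of "n + m - 1" "i - 1"] assms unfolding D_def
    by (simp flip: of_nat_mult of_nat_add add: mult.commute)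
  have 4: "real i * real (i - 1 choose (2*m - 1)) = real (2*m) * B"
    using Suc_times_binomial_eq[of "i - 1" "2*m - 1"] assms unfolding B_def
    by (simp flip: of_nat_mult of_nat_add add: mult.commute)
  have "real (n + m choose i) = D + real (n + m - 1 choose i)"
    using binomial_Suc_Suc[of "n + m - 1" "i - 1"] assms unfolding D_def by simp
  then have 2: "real i * real (n + m - 1 choose i) = (real (n + m) - real i) * D"
    using 1 by (simp add: algebra_simps)
  have "B = real (i - 1 choose (2*m - 1)) + real (i - 1 choose (2*m))"
    using binomial_Suc_Suc[of "i - 1" "2*m - 1"] assms unfolding B_def by simp
  then have 3: "real i * real (i - 1 choose (2*m)) = (real i - real (2*m)) * B"
    using 4 by (simp add: algebra_simps)
  \<comment> \<open>Two factors \<open>i\<close>, one for each binomial coefficient that is reduced by absorption.\<close>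
  have "real i * real i * real (card ?X) =
      2 * ((real i * real (i - 1 choose (2*m))) * (real i * real (n + m choose i))) +
      (real i * real (i - 1 choose (2*m - 1))) * (real i * real (n + m choose i) + real i * real (n + m - 1 choose i))"
    unfolding card by (simp add: algebra_simps)
  also have "\<dots> = real i * real (2*n) * B * D"
    unfolding 1 2 3 4 by (simp add: algebra_simps)
  finally show ?thesis
    using i0 unfolding B_def D_def by (simp add: field_simps)
qed

section \<open>Arcs of the cycle\<close>

definition next_vertex :: "nat \<Rightarrow> nat \<Rightarrow> nat" where
  "next_vertex n v = (if v = 2*n then 1 else v + 1)"

lemma next_vertex_in: "n \<ge> 1 \<Longrightarrow> v \<in> {1..2*n} \<Longrightarrow> next_vertex n v \<in> {1..2*n}"
  by (auto simp: next_vertex_def)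

lemma bij_betw_next_vertex:
  assumes "n \<ge> 1"
  shows "bij_betw (next_vertex n) {1..2*n} {1..2*n}"
proof -
  have "inj_on (next_vertex n) {1..2*n}"
    by (auto simp: inj_on_def next_vertex_def)
  moreover have "next_vertex n ` {1..2*n} \<subseteq> {1..2*n}"
    using next_vertex_in[OF assms] by blast
  ultimately show ?thesis
    by (simp add: bij_betw_def endo_inj_surj)
qed

lemma previous_cut_in:
  assumes "finite S" "S \<noteq> {}"
  shows "previous_cut S v \<in> S"
proof -
  have "Max {s\<in>S. s < v} \<in> {s\<in>S. s < v}" if "\<exists>s\<in>S. s < v"
    using that assms by (intro Max_in) auto
  then show ?thesis
    using assms by (auto simp: previous_cut_def)
qed

lemma previous_cut_next_vertex:
  assumes "n \<ge> 1" "S \<subseteq> {1..2*n}" "S \<noteq> {}" "v \<in> {1..2*n}"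
  shows "previous_cut S (next_vertex n v) = (if v \<in> S then v else previous_cut S v)"
proof -
  have fin: "finite S" using assms(2) by (rule finite_subset) simp
  show ?thesis
  proof (cases "v = 2*n")
    case True
    have "\<not> (\<exists>s\<in>S. s < 1)" using assms(2) by auto
    then have "previous_cut S (next_vertex n v) = Max S"
      by (simp add: previous_cut_def next_vertex_def True)
    moreover have "Max S = v" if "v \<in> S"
      using that assms(2) fin True by (intro Max_eqI) auto
    moreover have "previous_cut S v = Max S" if "v \<notin> S"
    proof -
      have "\<forall>s\<in>S. s < v"
        using that assms(2) True by (metis atLeastAtMost_iff order_le_less subsetD)
      then have "{s\<in>S. s < v} = S" by blast
      then show ?thesis by (simp add: previous_cut_def)
    qed
    ultimately show ?thesis by simp
  next
    case False
    have "Max {s\<in>S. s < v + 1} = v" if "v \<in> S"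
      using that fin by (intro Max_eqI) auto
    moreover have "{s\<in>S. s < v + 1} = {s\<in>S. s < v}" if "v \<notin> S"
      using that by (auto simp: less_Suc_eq)
    ultimately show ?thesis
      using False by (auto simp: previous_cut_def next_vertex_def less_Suc_eq)
  qed
qed

lemma previous_cut_image:
  assumes "n \<ge> 1" "S \<subseteq> {1..2*n}" "S \<noteq> {}"
  shows "previous_cut S ` {1..2*n} = S"
proof -
  have fin: "finite S" using assms(2) by (rule finite_subset) simp
  have "s \<in> previous_cut S ` {1..2*n}" if "s \<in> S" for s
    using previous_cut_next_vertex[OF assms, of s] next_vertex_in[OF assms(1), of s] that assms(2)
    by (metis image_eqI subsetD)
  then show ?thesis
    using previous_cut_in[OF fin assms(3)] by blast
qed

text \<open>
  Each arc contains exactly one cut, namely its last vertex; so arcs can be named by the cut before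
  them as well as by the cut that ends them.
\<close>

lemma bij_betw_previous_cut:
  assumes "finite S" "S \<noteq> {}"
  shows "bij_betw (previous_cut S) S S"
proof -
  have "previous_cut S t \<noteq> previous_cut S t'" if t: "t \<in> S" "t' \<in> S" "t < t'" for t t'
  proof -
    have "Max {s\<in>S. s < t'} \<ge> t"
      using t assms by (intro Max_ge) auto
    moreover have "Max {s\<in>S. s < t'} \<in> {s\<in>S. s < t'}"
      using t assms by (intro Max_in) auto
    ultimately have 1: "t \<le> previous_cut S t'" "previous_cut S t' < t'"
      using t by (auto simp: previous_cut_def)
    have "Max {s\<in>S. s < t} \<in> {s\<in>S. s < t}" if "\<exists>s\<in>S. s < t"
      using that assms by (intro Max_in) auto
    moreover have "Max S \<ge> t'"
      using t assms by simp
    ultimately have "previous_cut S t < t \<or> previous_cut S t \<ge> t'"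
      by (auto simp: previous_cut_def)
    then show ?thesis using 1 by linarith
  qed
  then have "inj_on (previous_cut S) S"
    by (intro linorder_inj_onI) auto
  moreover have "previous_cut S ` S \<subseteq> S"
    using previous_cut_in[OF assms] by blast
  ultimately show ?thesis
    using assms by (simp add: bij_betw_def endo_inj_surj)
qed

text \<open>
  Going backwards from \<open>v\<close> to the first vertex of its arc crosses no edge in \<open>S\<close>. If no element of \<open>S\<close>
  is below \<open>v\<close>, then the way leads through \<open>1\<close> and on from \<open>2 * n\<close> downwards.
\<close>

lemma constant_between_cuts:
  assumes "n \<ge> 1" "S \<subseteq> {1..2*n}" "S \<noteq> {}"
    and y: "\<And>v. v \<in> {1..2*n} - S \<Longrightarrow> y v = y (next_vertex n v)"
    and v: "v \<in> {1..2*n}"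
  shows "y v = y (next_vertex n (previous_cut S v))"
proof -
  have fin: "finite S" using assms(2) by (rule finite_subset) simp
  have run: "y a = y b" if "a \<le> b" "1 \<le> a" "b \<le> 2*n" "{a..<b} \<inter> S = {}" for a b
    using that
  proof (induction b rule: dec_induct)
    case (step b)
    have "b \<in> {1..2*n} - S" "next_vertex n b = Suc b"
      using step by (auto simp: next_vertex_def)
    moreover have "y a = y b"
      using step by (intro step.IH) (auto simp: disjoint_iff)
    ultimately show ?case
      using y[of b] by simp
  qed simp
  show ?thesis
  proof (cases "\<exists>s\<in>S. s < v")
    case True
    define s where "s = Max {s\<in>S. s < v}"
    have s: "s \<in> {s\<in>S. s < v}"
      unfolding s_def using True fin by (intro Max_in) auto
    have "r \<le> s" if "r \<in> S" "r < v" for r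
      unfolding s_def using that fin by (intro Max_ge) auto
    then have "{s + 1..<v} \<inter> S = {}"
      by (force simp: disjoint_iff)
    then have "y (s + 1) = y v"
      using s v by (intro run) auto
    moreover have "previous_cut S v = s" "next_vertex n s = s + 1"
      using True s v by (auto simp: previous_cut_def s_def next_vertex_def)
    ultimately show ?thesis by simp
  next
    case False
    define s where "s = Max S"
    have s: "s \<in> S" unfolding s_def using fin assms(3) by simp
    have "y 1 = y v"
      using False v by (intro run) auto
    moreover have "y (next_vertex n s) = y 1"
    proof (cases "s = 2*n")
      case F: False
      have max: "r \<le> s" if "r \<in> S" for r
        unfolding s_def using that fin by simp
      have sN: "s < 2*n" using s F assms(2) by (metis atLeastAtMost_iff order_le_less subsetD)
      have "y (s + 1) = y (2*n)"
        using max sN by (intro run) (auto simp: disjoint_iff, force)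
      moreover have "2*n \<notin> S" using max sN by (meson leD)
      then have "y (2*n) = y 1"
        using y[of "2*n"] assms(1) by (simp add: next_vertex_def)
      ultimately show ?thesis
        using F by (simp add: next_vertex_def)
    qed (simp add: next_vertex_def)
    ultimately show ?thesis
      using False by (simp add: previous_cut_def s_def)
  qed
qed

text \<open>
  Without a cyclic change the parity propagates from each element of \<open>S\<close> to the next.
\<close>

lemma cyclic_changes_nonempty_iff:
  assumes "finite S"
  shows "cyclic_changes S \<noteq> {} \<longleftrightarrow> (\<exists>s\<in>S. odd s) \<and> (\<exists>s\<in>S. even s)"
proof
  assume "cyclic_changes S \<noteq> {}"
  then obtain t where "t \<in> S" "odd t \<noteq> odd (previous_cut S t)"
    by (auto simp: cyclic_changes_def)
  moreover from this have "previous_cut S t \<in> S"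
    using previous_cut_in[OF assms] by blast
  ultimately show "(\<exists>s\<in>S. odd s) \<and> (\<exists>s\<in>S. even s)" by blast
next
  assume R: "(\<exists>s\<in>S. odd s) \<and> (\<exists>s\<in>S. even s)"
  show "cyclic_changes S \<noteq> {}"
  proof
    assume E: "cyclic_changes S = {}"
    have "odd t = odd (Max S)" if "t \<in> S" for t
      using that
    proof (induction t rule: less_induct)
      case (less t)
      have t: "odd t = odd (previous_cut S t)"
        using E less.prems by (auto simp: cyclic_changes_def)
      show ?case
      proof (cases "\<exists>s\<in>S. s < t")
        case True
        then have "Max {s\<in>S. s < t} \<in> {s\<in>S. s < t}"
          using assms by (intro Max_in) auto
        then show ?thesis
          using t True less.IH[of "Max {s\<in>S. s < t}"] by (simp add: previous_cut_def)
      qed (use t in \<open>simp add: previous_cut_def\<close>)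
    qed
    then show False using R by blast
  qed
qed

section \<open>Labellings of the crown\<close>

definition in_crown :: "nat \<Rightarrow> (nat \<Rightarrow> real) \<Rightarrow> bool" where
  "in_crown n y \<longleftrightarrow> (\<forall>v\<in>{1..2*n}. 0 \<le> y v \<and> y v \<le> 1 \<and>
     (if odd v then y v \<le> y (next_vertex n v) else y (next_vertex n v) \<le> y v))"

definition cuts :: "nat \<Rightarrow> (nat \<Rightarrow> real) \<Rightarrow> nat set" where
  "cuts n y = {v\<in>{1..2*n}. y v \<noteq> y (next_vertex n v)}"

text \<open>
  The arcs of value \<open>0\<close> or \<open>1\<close>, each represented by its last vertex.
\<close>

definition pinned :: "nat \<Rightarrow> (nat \<Rightarrow> real) \<Rightarrow> nat set" where
  "pinned n y = {v \<in> cuts n y. y v = 0 \<or> y v = 1}"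

lemma cuts_subset: "cuts n y \<subseteq> {1..2*n}"
  by (auto simp: cuts_def)

lemma finite_cuts: "finite (cuts n y)"
  by (simp add: cuts_def)

lemma constant_if_no_cuts:
  assumes "cuts n y = {}" "v \<in> {1..2*n}"
  shows "y v = y 1"
proof -
  have "1 \<le> v" "v \<le> 2*n" using assms(2) by auto
  then show ?thesis
  proof (induction v rule: dec_induct)
    case (step v)
    then have "y v = y (next_vertex n v)"
      using assms(1) by (auto simp: cuts_def)
    then show ?case using step by (auto simp: next_vertex_def)
  qed simp
qed

text \<open>
  The increments along all edges of the cycle add up to zero, so a nonzero increment entails one of
  each sign; the ascents are odd and the descents are even.
\<close>

lemma cuts_both_parities:
  assumes "n \<ge> 1" "in_crown n y" "cuts n y \<noteq> {}"
  shows "\<exists>s\<in>cuts n y. odd s" "\<exists>s\<in>cuts n y. even s"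
proof -
  let ?d = "\<lambda>v. y (next_vertex n v) - y v"
  have sum0: "sum ?d {1..2*n} = 0"
    using sum.reindex_bij_betw[OF bij_betw_next_vertex[OF assms(1)], of y] by (simp add: sum_subtractf)
  obtain s where s: "s \<in> {1..2*n}" "?d s \<noteq> 0"
    using assms(3) by (auto simp: cuts_def)
  have d: "odd v \<Longrightarrow> ?d v \<ge> 0" "even v \<Longrightarrow> ?d v \<le> 0" if "v \<in> {1..2*n}" for v
    using that assms(2) by (auto simp: in_crown_def)
  have sign: "\<exists>v\<in>{1..2*n}. e v < 0" if e: "e = ?d \<or> e = (\<lambda>v. - ?d v)" for e
  proof (rule ccontr)
    assume "\<not> ?thesis"
    then have "\<And>v. v \<in> {1..2*n} \<Longrightarrow> 0 \<le> e v" by (meson not_less)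
    moreover have "sum e {1..2*n} = 0"
      using e sum0 by (auto simp: sum_subtractf)
    ultimately have "e s = 0"
      using s(1) sum_nonneg_eq_0_iff[of "{1..2*n}" e] by blast
    then show False using s(2) e by auto
  qed
  obtain u v where "u \<in> {1..2*n}" "?d u > 0" "v \<in> {1..2*n}" "?d v < 0"
    using sign[of ?d] sign[of "\<lambda>v. - ?d v"] by auto
  then have "u \<in> cuts n y" "odd u" "v \<in> cuts n y" "even v"
    using d(2)[of u] d(1)[of v] by (auto simp: cuts_def)
  then show "\<exists>s\<in>cuts n y. odd s" "\<exists>s\<in>cuts n y. even s"
    by blast+
qed

lemma constant_on_arc:
  assumes "n \<ge> 1" "cuts n y \<noteq> {}" "v \<in> {1..2*n}"
  shows "y v = y (next_vertex n (previous_cut (cuts n y) v))"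
  by (rule constant_between_cuts[OF assms(1) cuts_subset assms(2) _ assms(3)]) (auto simp: cuts_def)

text \<open>
  The cut \<open>s\<close> before an arc tells its extreme value: if \<open>s\<close> is odd, the value rises there, so it
  cannot be \<open>0\<close> afterwards; if \<open>s\<close> is even, it falls and cannot be \<open>1\<close>. Hence the cuts and the pinned
  arcs determine where \<open>y\<close> takes the values \<open>0\<close> and \<open>1\<close>.
\<close>

lemma pinned_value:
  assumes "n \<ge> 1" "in_crown n y" "cuts n y \<noteq> {}" "v \<in> {1..2*n}"
  shows "y v = 0 \<longleftrightarrow> previous_cut (cuts n y) v \<in> previous_cut (cuts n y) ` pinned n y
            \<and> even (previous_cut (cuts n y) v)" (is ?zero)
    and "y v = 1 \<longleftrightarrow> previous_cut (cuts n y) v \<in> previous_cut (cuts n y) ` pinned n y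
            \<and> odd (previous_cut (cuts n y) v)" (is ?one)
proof -
  define s where "s = previous_cut (cuts n y) v"
  note bij = bij_betw_previous_cut[OF finite_cuts assms(3)]
  have s: "s \<in> cuts n y"
    unfolding s_def using previous_cut_in[OF finite_cuts assms(3)] .
  then obtain t where t: "t \<in> cuts n y" "previous_cut (cuts n y) t = s"
    using bij by (metis bij_betw_imp_surj_on imageE)
  have "t \<in> {1..2*n}" using t(1) cuts_subset by blast
  then have ys: "y v = y (next_vertex n s)" "y t = y (next_vertex n s)"
    using constant_on_arc[OF assms(1,3)] assms(4) t(2) s_def by simp_all
  have pin: "s \<in> previous_cut (cuts n y) ` pinned n y \<longleftrightarrow> y v = 0 \<or> y v = 1"
  proof -
    have "s \<in> previous_cut (cuts n y) ` pinned n y \<longleftrightarrow> t \<in> pinned n y"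
      using bij t by (auto simp: pinned_def bij_betw_def inj_on_def)
    then show ?thesis using t(1) ys by (simp add: pinned_def)
  qed
  have sN: "s \<in> {1..2*n}" "next_vertex n s \<in> {1..2*n}" "y s \<noteq> y (next_vertex n s)"
    using s next_vertex_in[OF assms(1)] by (auto simp: cuts_def)
  have "0 \<le> y s" "y s \<le> 1" "0 \<le> y (next_vertex n s)" "y (next_vertex n s) \<le> 1"
    "odd s \<Longrightarrow> y s \<le> y (next_vertex n s)" "even s \<Longrightarrow> y (next_vertex n s) \<le> y s"
    using assms(2) sN(1,2) by (auto simp: in_crown_def)
  then have "odd s \<Longrightarrow> y v \<noteq> 0" "even s \<Longrightarrow> y v \<noteq> 1"
    using sN(3) ys(1) by auto
  then show ?zero ?one
    using pin unfolding s_def[symmetric] by auto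
qed

text \<open>
  A pinned arc lies below both neighbours or above both, hence is entered and left through edges of
  opposite parity.
\<close>

lemma pinned_subset_cyclic_changes:
  assumes "n \<ge> 1" "in_crown n y"
  shows "pinned n y \<subseteq> cyclic_changes (cuts n y)"
proof
  fix t assume t: "t \<in> pinned n y"
  then have tc: "t \<in> cuts n y" "t \<in> {1..2*n}" "y t \<noteq> y (next_vertex n t)"
    by (auto simp: pinned_def cuts_def)
  have ne: "cuts n y \<noteq> {}" using tc by blast
  have "0 \<le> y (next_vertex n t)" "y (next_vertex n t) \<le> 1"
    "odd t \<Longrightarrow> y t \<le> y (next_vertex n t)" "even t \<Longrightarrow> y (next_vertex n t) \<le> y t"
    using assms(2) tc(2) next_vertex_in[OF assms(1)] by (auto simp: in_crown_def)
  then have "y t = 0 \<Longrightarrow> odd t" "y t = 1 \<Longrightarrow> even t"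
    using tc(3) by auto
  then have "odd t \<noteq> odd (previous_cut (cuts n y) t)"
    using pinned_value[OF assms ne tc(2)] t unfolding pinned_def by fastforce
  then show "t \<in> cyclic_changes (cuts n y)"
    using tc by (simp add: cyclic_changes_def)
qed

text \<open>
  Every combinatorially possible pair is realised. The height \<open>h\<close> rises by \<open>q\<close> at each of the \<open>p\<close> odd
  cuts and falls by \<open>p\<close> at each of the \<open>q\<close> even ones, so that it closes up around the cycle; \<open>z\<close> rescales
  it into the open unit interval, and \<open>y\<close> moves the arcs in \<open>Z\<close> to their extreme value. This keeps the
  inequality across each cut strict, because the arc before an odd cut can only have been moved to \<open>0\<close>
  and the arc after it only to \<open>1\<close>, and conversely for an even cut.
\<close>

lemma exists_labelling:
  assumes "n \<ge> 1" "S \<subseteq> {1..2*n}" "cyclic_changes S \<noteq> {}" "Z \<subseteq> cyclic_changes S"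
  shows "\<exists>y. in_crown n y \<and> cuts n y = S \<and> pinned n y = Z"
proof -
  have fin: "finite S" using assms(2) by (rule finite_subset) simp
  have ne: "S \<noteq> {}" using assms(3) by (auto simp: cyclic_changes_def)
  have ZS: "Z \<subseteq> S" using assms(4) by (auto simp: cyclic_changes_def)
  note next_cut = previous_cut_next_vertex[OF assms(1,2) ne]
  define p where "p = real (card {s\<in>S. odd s})"
  define q where "q = real (card {s\<in>S. even s})"
  have pq: "p > 0" "q > 0"
    using assms(3) cyclic_changes_nonempty_iff[OF fin] fin
    by (auto simp: p_def q_def card_gt_0_iff)
  define w where "w u = (if u \<in> S then if odd u then q else - p else 0)" for u
  define h where "h v = (\<Sum>u\<in>{1..<v}. w u)" for v
  have "(\<Sum>u\<in>{1..2*n}. w u) = (\<Sum>u\<in>S. if odd u then q else - p)"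
    unfolding w_def using assms(2) by (simp add: sum.inter_restrict[symmetric] Int_absorb1)
  also have "\<dots> = 0"
    using fin by (simp add: sum.If_cases p_def q_def Int_def)
  finally have w0: "(\<Sum>u\<in>{1..2*n}. w u) = 0" .
  have h: "h (next_vertex n v) = h v + w v" if v: "v \<in> {1..2*n}" for v
  proof -
    have "h (Suc v) = h v + w v"
      using v by (simp add: h_def)
    moreover have "h (Suc (2*n)) = h 1"
      using w0 by (simp add: h_def atLeastLessThanSuc_atLeastAtMost)
    ultimately show ?thesis by (auto simp: next_vertex_def)
  qed
  define B where "B = 1 + (\<Sum>v\<in>{1..2*n}. \<bar>h v\<bar>)"
  have B: "\<bar>h v\<bar> < B" if "v \<in> {1..2*n}" for v
    using member_le_sum[of v "{1..2*n}" "\<lambda>v. \<bar>h v\<bar>"] that by (simp add: B_def)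
  have B0: "B > 0" by (simp add: B_def add_pos_nonneg sum_nonneg)
  define z where "z v = 1/2 + h v / (2*B)" for v
  have z: "0 < z v" "z v < 1" if "v \<in> {1..2*n}" for v
    using B[OF that] B0 by (auto simp: z_def field_simps abs_less_iff)
  have zn: "z (next_vertex n v) = z v + w v / (2*B)" if "v \<in> {1..2*n}" for v
    using h[OF that] by (simp add: z_def add_divide_distrib)
  define pre where "pre = previous_cut S"
  define y where "y v = (if pre v \<in> pre ` Z then if odd (pre v) then 1 else 0 else z v)" for v
  have pin: "pre v \<in> pre ` Z \<longleftrightarrow> v \<in> Z" if "v \<in> S" for v
    using bij_betw_previous_cut[OF fin ne] ZS that by (auto simp: pre_def bij_betw_def inj_on_def)
  have Zpar: "odd v \<noteq> odd (pre v)" if "v \<in> Z" for v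
    using that assms(4) by (auto simp: cyclic_changes_def pre_def)
  have y01: "0 \<le> y v" "y v \<le> 1" if "v \<in> {1..2*n}" for v
    using z[OF that] by (auto simp: y_def)
  have same: "y (next_vertex n v) = y v" if "v \<in> {1..2*n}" "v \<notin> S" for v
    using next_cut[OF that(1)] zn[OF that(1)] that(2) by (simp add: y_def w_def pre_def)
  have step: "if odd v then y v < y (next_vertex n v) else y (next_vertex n v) < y v" if v: "v \<in> S" for v
  proof -
    have vN: "v \<in> {1..2*n}" using v assms(2) by blast
    have "pre (next_vertex n v) = v" using next_cut[OF vN] v by (simp add: pre_def)
    then have yn: "y (next_vertex n v) = (if v \<in> pre ` Z then if odd v then 1 else 0 else z (next_vertex n v))"
      by (simp add: y_def)
    have yv: "y v = (if v \<in> Z then if odd v then 0 else 1 else z v)"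
      using pin[OF v] Zpar by (auto simp: y_def)
    have "if odd v then z v < z (next_vertex n v) else z (next_vertex n v) < z v"
      using zn[OF vN] v pq B0 by (simp add: w_def)
    then show ?thesis
      using z[OF vN] z[OF next_vertex_in[OF assms(1) vN]] unfolding yn yv by auto
  qed
  have "in_crown n y"
    unfolding in_crown_def using y01 same step by (metis less_imp_le order_refl)
  moreover have cuts: "cuts n y = S"
    using same step assms(2) unfolding cuts_def by (force split: if_splits)
  moreover have "pinned n y = Z"
  proof -
    have "y v = 0 \<or> y v = 1 \<longleftrightarrow> v \<in> Z" if v: "v \<in> S" for v
    proof -
      have "v \<in> {1..2*n}" using v assms(2) by blast
      then show ?thesis using pin[OF v] z[of v] by (auto simp: y_def)
    qed
    then show ?thesis
      unfolding pinned_def cuts using ZS by blast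
  qed
  ultimately show ?thesis by blast
qed

section \<open>Tight constraints of the order polytope of the crown\<close>

definition order_constraints :: "('d \<times> 'd) set \<Rightarrow> ((real ^ 'd) \<times> real) set" where
  "order_constraints r = range (\<lambda>i. (- axis i 1, 0)) \<union> range (\<lambda>i. (axis i 1, 1)) \<union>
     (\<lambda>(i, j). (axis i 1 - axis j 1, 0)) ` r"

lemma finite_order_constraints: "finite (order_constraints (r :: ('d::finite \<times> 'd) set))"
  by (simp add: order_constraints_def)

lemma order_polytope_eq_polyhedron_of: "order_polytope r = polyhedron_of (order_constraints r)"
  by (force simp: order_polytope_def polyhedron_of_def order_constraints_def inner_axis' inner_diff_left ball_Un)

lemma tight_order_constraints_eq_iff:
  fixes x y :: "real ^ 'd::finite"
  shows "tight (order_constraints r) x = tight (order_constraints r) y \<longleftrightarrow>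
    (\<forall>i. x $ i = 0 \<longleftrightarrow> y $ i = 0) \<and> (\<forall>i. x $ i = 1 \<longleftrightarrow> y $ i = 1) \<and>
    (\<forall>i j. (i, j) \<in> r \<longrightarrow> (x $ i = x $ j \<longleftrightarrow> y $ i = y $ j))"
proof -
  have "tight H x = tight H y \<longleftrightarrow> (\<forall>h\<in>H. fst h \<bullet> x = snd h \<longleftrightarrow> fst h \<bullet> y = snd h)"
    for H :: "((real ^ 'd) \<times> real) set"
    by (auto simp: tight_def)
  then show ?thesis
    by (auto simp: order_constraints_def inner_axis' inner_diff_left ball_Un)
qed

lemma tight_directions_order_constraints:
  fixes x :: "real ^ 'd::finite"
  shows "tight_directions (order_constraints r) x =
    {d. (\<forall>i. x $ i = 0 \<or> x $ i = 1 \<longrightarrow> d $ i = 0) \<and>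
        (\<forall>i j. (i, j) \<in> r \<longrightarrow> x $ i = x $ j \<longrightarrow> d $ i = d $ j)}"
proof -
  have "tight_directions H x = {d. \<forall>h\<in>H. fst h \<bullet> x = snd h \<longrightarrow> fst h \<bullet> d = 0}"
    for H :: "((real ^ 'd) \<times> real) set"
    by (auto simp: tight_directions_def tight_def)
  then show ?thesis
    by (auto simp: order_constraints_def inner_axis' inner_diff_left ball_Un)
qed

lemma crown_covers_all_iff:
  assumes "n \<ge> 1"
  shows "(\<forall>i j. (i, j) \<in> crown_covers n \<longrightarrow> Q i j) \<longleftrightarrow>
    (\<forall>v\<in>{1..2*n}. if odd v then Q v (next_vertex n v) else Q (next_vertex n v) v)"
    (is "?L \<longleftrightarrow> ?R")
proof
  assume L: ?L
  show ?R
  proof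
    fix v assume v: "v \<in> {1..2*n}"
    show "if odd v then Q v (next_vertex n v) else Q (next_vertex n v) v"
    proof (cases "odd v")
      case True
      then have "v \<noteq> 2*n" by auto
      then have "(v, next_vertex n v) \<in> crown_covers n"
        using v True by (simp add: crown_covers_def next_vertex_def)
      then show ?thesis using L True by simp
    next
      case False
      then have "(next_vertex n v, v) \<in> crown_covers n"
        using v next_vertex_in[OF assms v] by (auto simp: crown_covers_def next_vertex_def)
      then show ?thesis using L False by simp
    qed
  qed
next
  assume R: ?R
  show ?L
  proof (intro allI impI)
    fix i j assume "(i, j) \<in> crown_covers n"
    then have i: "i \<in> {1..2*n}" "odd i" and j: "j = i + 1 \<or> j = (if i = 1 then 2*n else i - 1)"
      by (auto simp: crown_covers_def)
    have "i \<noteq> 2*n" using i by auto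
    show "Q i j"
    proof (cases "j = i + 1")
      case True
      then show ?thesis using bspec[OF R i(1)] i \<open>i \<noteq> 2*n\<close> by (simp add: next_vertex_def)
    next
      case False
      then have j': "j = (if i = 1 then 2*n else i - 1)" using j by simp
      then have "j \<in> {1..2*n}" "even j" "next_vertex n j = i"
        using i assms by (auto simp: next_vertex_def)
      then show ?thesis using bspec[OF R, of j] by simp
    qed
  qed
qed

lemma crown_relation_all_iff:
  fixes lab :: "'d::finite \<Rightarrow> nat"
  assumes "n \<ge> 1" "bij_betw lab UNIV {1..2*n}" "\<And>a. Q a a"
  shows "(\<forall>a b. (a, b) \<in> inv_image (crown_poset n) lab \<longrightarrow> Q a b) \<longleftrightarrow>
    (\<forall>v\<in>{1..2*n}. if odd v then Q (inv lab v) (inv lab (next_vertex n v))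
                  else Q (inv lab (next_vertex n v)) (inv lab v))"
proof -
  have inj: "inj lab" using assms(2) by (simp add: bij_betw_def)
  have inv: "lab (inv lab v) = v" if "v \<in> {1..2*n}" for v
    using that assms(2) by (simp add: bij_betw_def f_inv_into_f)
  have "(\<forall>a b. (a, b) \<in> inv_image (crown_poset n) lab \<longrightarrow> Q a b) \<longleftrightarrow>
      (\<forall>i j. (i, j) \<in> crown_covers n \<longrightarrow> Q (inv lab i) (inv lab j))" (is "?L \<longleftrightarrow> ?R")
  proof
    assume L: ?L
    show ?R
    proof (intro allI impI)
      fix i j assume ij: "(i, j) \<in> crown_covers n"
      then have "lab (inv lab i) = i" "lab (inv lab j) = j"
        using crown_coversD[OF ij] inv by simp_all
      then show "Q (inv lab i) (inv lab j)"
        using L ij by (simp add: crown_poset_def trans_crown_covers)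
    qed
  next
    assume R: ?R
    show ?L
    proof (intro allI impI)
      fix a b assume "(a, b) \<in> inv_image (crown_poset n) lab"
      then have "a = b \<or> (lab a, lab b) \<in> crown_covers n"
        using inj by (auto simp: crown_poset_def trans_crown_covers inj_eq)
      then show "Q a b"
        using R assms(3) inv_f_f[OF inj] by metis
    qed
  qed
  then show ?thesis
    using crown_covers_all_iff[OF assms(1), of "\<lambda>i j. Q (inv lab i) (inv lab j)"] by simp
qed

text \<open>
  The coordinate vector as a labelling of the vertices of the cycle.
\<close>

definition coords :: "('d \<Rightarrow> nat) \<Rightarrow> real ^ 'd \<Rightarrow> nat \<Rightarrow> real" where
  "coords lab x v = x $ inv lab v"

text \<open>
  The number of arcs whose value is neither \<open>0\<close> nor \<open>1\<close>; without any cut the whole cycle is a single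
  such block or a pinned one.
\<close>

definition face_dim :: "nat \<Rightarrow> (nat \<Rightarrow> real) \<Rightarrow> nat" where
  "face_dim n y =
    (if cuts n y = {} then if y 1 = 0 \<or> y 1 = 1 then 0 else 1 else card (cuts n y) - card (pinned n y))"

text \<open>
  The information about \<open>y\<close> that is equivalent to the set of tight constraints.
\<close>

definition tight_pattern :: "nat \<Rightarrow> (nat \<Rightarrow> real) \<Rightarrow> nat set \<times> nat set \<times> nat set" where
  "tight_pattern n y = (cuts n y, {v\<in>{1..2*n}. y v = 0}, {v\<in>{1..2*n}. y v = 1})"

context
  fixes n :: nat and lab :: "'d::finite \<Rightarrow> nat"
  assumes n: "n \<ge> 1" and lab: "bij_betw lab UNIV {1..2*n}"
begin

lemma inv_lab: "inv lab (lab a) = a" "v \<in> {1..2*n} \<Longrightarrow> lab (inv lab v) = v" "lab a \<in> {1..2*n}"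
  using lab by (auto simp: bij_betw_def f_inv_into_f)

lemma all_lab_iff: "(\<forall>a. Q a) \<longleftrightarrow> (\<forall>v\<in>{1..2*n}. Q (inv lab v))"
  using inv_lab by metis

lemma order_polytope_crown_iff:
  "x \<in> order_polytope (inv_image (crown_poset n) lab) \<longleftrightarrow> in_crown n (coords lab x)"
  unfolding order_polytope_def in_crown_def mem_Collect_eq coords_def
    crown_relation_all_iff[OF n lab, of "\<lambda>i j. x $ i \<le> x $ j", OF order_refl]
    all_lab_iff[of "\<lambda>i. 0 \<le> x $ i \<and> x $ i \<le> 1"]
  by (simp only: ball_conj_distrib conj_assoc)

lemma tight_crown_eq_iff:
  "tight (order_constraints (inv_image (crown_poset n) lab)) x =
     tight (order_constraints (inv_image (crown_poset n) lab)) y \<longleftrightarrow>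
   tight_pattern n (coords lab x) = tight_pattern n (coords lab y)"
proof -
  have cuts_eq: "cuts n y = cuts n z \<longleftrightarrow>
      (\<forall>v\<in>{1..2*n}. y v = y (next_vertex n v) \<longleftrightarrow> z v = z (next_vertex n v))" for y z
    unfolding cuts_def by blast
  have "(\<forall>a b. (a, b) \<in> inv_image (crown_poset n) lab \<longrightarrow> (x $ a = x $ b \<longleftrightarrow> y $ a = y $ b)) \<longleftrightarrow>
      cuts n (coords lab x) = cuts n (coords lab y)"
    unfolding cuts_eq coords_def
    by (subst crown_relation_all_iff[OF n lab, of "\<lambda>a b. x $ a = x $ b \<longleftrightarrow> y $ a = y $ b"])
      (simp, intro ball_cong refl, metis (full_types))
  moreover have "(\<forall>a. x $ a = c \<longleftrightarrow> y $ a = c) \<longleftrightarrow>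
      {v\<in>{1..2*n}. coords lab x v = c} = {v\<in>{1..2*n}. coords lab y v = c}" for c
    unfolding all_lab_iff[of "\<lambda>a. x $ a = c \<longleftrightarrow> y $ a = c"] coords_def by blast
  ultimately show ?thesis
    unfolding tight_order_constraints_eq_iff tight_pattern_def prod.inject by blast
qed

lemma coords_of_vec: "v \<in> {1..2*n} \<Longrightarrow> coords lab (\<chi> a. y (lab a)) v = y v"
  using inv_lab by (simp add: coords_def)

lemma tight_directions_crown:
  "tight_directions (order_constraints (inv_image (crown_poset n) lab)) x =
    {d. (\<forall>v\<in>{1..2*n}. coords lab x v = 0 \<or> coords lab x v = 1 \<longrightarrow> coords lab d v = 0) \<and>
        (\<forall>v\<in>{1..2*n} - cuts n (coords lab x). coords lab d v = coords lab d (next_vertex n v))}"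
proof -
  have "(\<forall>a b. (a, b) \<in> inv_image (crown_poset n) lab \<longrightarrow> x $ a = x $ b \<longrightarrow> d $ a = d $ b) \<longleftrightarrow>
      (\<forall>v\<in>{1..2*n} - cuts n (coords lab x). coords lab d v = coords lab d (next_vertex n v))" for d :: "real ^ 'd"
  proof -
    have "(\<forall>v\<in>{1..2*n} - cuts n (coords lab x). coords lab d v = coords lab d (next_vertex n v)) \<longleftrightarrow>
        (\<forall>v\<in>{1..2*n}. x $ inv lab v = x $ inv lab (next_vertex n v) \<longrightarrow>
           d $ inv lab v = d $ inv lab (next_vertex n v))"
      unfolding cuts_def coords_def by blast
    also have "\<dots> \<longleftrightarrow> (\<forall>a b. (a, b) \<in> inv_image (crown_poset n) lab \<longrightarrow> x $ a = x $ b \<longrightarrow> d $ a = d $ b)"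
      by (subst crown_relation_all_iff[OF n lab, of "\<lambda>a b. x $ a = x $ b \<longrightarrow> d $ a = d $ b"])
        (simp, intro ball_cong refl, metis (full_types))
    finally show ?thesis ..
  qed
  moreover have "(\<forall>a. x $ a = 0 \<or> x $ a = 1 \<longrightarrow> d $ a = 0) \<longleftrightarrow>
      (\<forall>v\<in>{1..2*n}. coords lab x v = 0 \<or> coords lab x v = 1 \<longrightarrow> coords lab d v = 0)" for d :: "real ^ 'd"
    unfolding all_lab_iff[of "\<lambda>a. x $ a = 0 \<or> x $ a = 1 \<longrightarrow> d $ a = 0"] coords_def ..
  ultimately show ?thesis
    unfolding tight_directions_order_constraints by simp
qed

text \<open>
  A direction stays tight if it is constant on arcs and vanishes on the pinned ones, so one free
  parameter per unpinned arc remains.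
\<close>

lemma dim_tight_directions_crown:
  assumes x: "in_crown n (coords lab x)"
  shows "dim (tight_directions (order_constraints (inv_image (crown_poset n) lab)) x) =
    face_dim n (coords lab x)"
proof (cases "cuts n (coords lab x) = {}")
  case True
  let ?y = "coords lab x"
  let ?K = "if ?y 1 = 0 \<or> ?y 1 = 1 then UNIV else {} :: unit set"
  have "tight_directions (order_constraints (inv_image (crown_poset n) lab)) x =
    {d. (\<forall>a. () \<in> ?K \<longrightarrow> d $ a = 0) \<and> (\<forall>a b. () = () \<longrightarrow> d $ a = d $ b)}" (is "?L = ?R")
  proof -
    have "(\<forall>v\<in>{1..2*n}. coords lab d v = coords lab d (next_vertex n v)) \<longleftrightarrow> 
        (\<forall>a b. d $ a = d $ b)" for d :: "real ^ 'd"
    proof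
      assume "\<forall>v\<in>{1..2*n}. coords lab d v = coords lab d (next_vertex n v)"
      then have "cuts n (coords lab d) = {}" by (auto simp: cuts_def)
      from constant_if_no_cuts[OF this inv_lab(3)] have "d $ a = d $ inv lab 1" for a
        by (simp add: coords_def inv_lab(1))
      then show "\<forall>a b. d $ a = d $ b"
        by metis
    qed (simp add: coords_def)
    moreover have "(\<forall>v\<in>{1..2*n}. ?y v = 0 \<or> ?y v = 1 \<longrightarrow> coords lab d v = 0) \<longleftrightarrow>
        (\<forall>a. () \<in> ?K \<longrightarrow> d $ a = 0)" for d :: "real ^ 'd"
    proof -
      have "(?y v = 0 \<or> ?y v = 1 \<longrightarrow> coords lab d v = 0) \<longleftrightarrow> (() \<in> ?K \<longrightarrow> coords lab d v = 0)"
        if "v \<in> {1..2*n}" for v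
        using constant_if_no_cuts[OF True that] by simp
      then show ?thesis
        unfolding all_lab_iff[of "\<lambda>a. () \<in> ?K \<longrightarrow> d $ a = 0"] coords_def[of lab d, symmetric]
        by (intro ball_cong refl)
    qed
    ultimately show ?thesis
      unfolding tight_directions_crown True by simp
  qed
  then have "dim ?L = card (range (\<lambda>a::'d. ()) - ?K)"
    by (simp only: dim_block_constant[of "\<lambda>a::'d. ()" ?K])
  moreover have "range (\<lambda>a::'d. ()) = UNIV"
    by auto
  then have "card (range (\<lambda>a::'d. ()) - ?K) = (if ?y 1 = 0 \<or> ?y 1 = 1 then 0 else 1)"
    by (simp only:) simp
  ultimately show ?thesis
    by (simp only: face_dim_def True simp_thms if_True)
next
  case False
  let ?y = "coords lab x"
  let ?S = "cuts n ?y" and ?Z = "pinned n ?y"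
  let ?pre = "previous_cut ?S"
  let ?c = "\<lambda>a. ?pre (lab a)"
  note bij = bij_betw_previous_cut[OF finite_cuts False]
  have next_cut: "?pre (next_vertex n v) = (if v \<in> ?S then v else ?pre v)" if "v \<in> {1..2*n}" for v
    by (rule previous_cut_next_vertex[OF n cuts_subset False that])
  have "tight_directions (order_constraints (inv_image (crown_poset n) lab)) x =
    {d. (\<forall>a. ?c a \<in> ?pre ` ?Z \<longrightarrow> d $ a = 0) \<and> (\<forall>a b. ?c a = ?c b \<longrightarrow> d $ a = d $ b)}"
  proof -
    have "(\<forall>v\<in>{1..2*n} - ?S. coords lab d v = coords lab d (next_vertex n v)) \<longleftrightarrow>
        (\<forall>a b. ?c a = ?c b \<longrightarrow> d $ a = d $ b)" (is "?A \<longleftrightarrow> ?B") for d :: "real ^ 'd"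
    proof
      assume A: ?A
      have const: "coords lab d (lab a) = coords lab d (next_vertex n (?c a))" for a
        by (rule constant_between_cuts[OF n cuts_subset False _ inv_lab(3)]) (rule bspec[OF A])
      have "d $ a = coords lab d (next_vertex n (?c a))" for a
        using const[of a] unfolding coords_def[of lab d "lab a"] inv_lab(1) .
      then show ?B
        by metis
    next
      assume B: ?B
      show ?A
      proof
        fix v assume v: "v \<in> {1..2*n} - ?S"
        then have same_arc: "?c (inv lab v) = ?c (inv lab (next_vertex n v))"
          using next_cut[of v] next_vertex_in[OF n, of v] inv_lab(2) by simp
        show "coords lab d v = coords lab d (next_vertex n v)"
          unfolding coords_def[of lab d] by (rule B[rule_format, OF same_arc])
      qed
    qed
    moreover have "(?y v = 0 \<or> ?y v = 1) \<longleftrightarrow> ?pre v \<in> ?pre ` ?Z" if "v \<in> {1..2*n}" for v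
      using pinned_value[OF n x False that] by (cases "even (?pre v)") simp_all
    then have "(?y v = 0 \<or> ?y v = 1 \<longrightarrow> coords lab d v = 0) \<longleftrightarrow>
        (?c (inv lab v) \<in> ?pre ` ?Z \<longrightarrow> d $ inv lab v = 0)" if "v \<in> {1..2*n}" for v and d :: "real ^ 'd"
      by (simp only: that inv_lab(2)[OF that] coords_def[of lab d])
    then have "(\<forall>v\<in>{1..2*n}. ?y v = 0 \<or> ?y v = 1 \<longrightarrow> coords lab d v = 0) \<longleftrightarrow>
        (\<forall>a. ?c a \<in> ?pre ` ?Z \<longrightarrow> d $ a = 0)" for d :: "real ^ 'd"
      unfolding all_lab_iff[of "\<lambda>a. ?c a \<in> ?pre ` ?Z \<longrightarrow> d $ a = 0"] by (rule ball_cong[OF refl])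
    ultimately show ?thesis
      unfolding tight_directions_crown by simp
  qed
  moreover have "range ?c = ?S"
  proof -
    have "range ?c = ?pre ` range lab" by (simp add: image_image)
    then show ?thesis
      using previous_cut_image[OF n cuts_subset False] lab by (simp add: bij_betw_def)
  qed
  moreover have "card (?S - ?pre ` ?Z) = card ?S - card ?Z"
  proof -
    have "?Z \<subseteq> ?S" by (auto simp: pinned_def)
    then have "inj_on ?pre ?Z" "?pre ` ?Z \<subseteq> ?S"
      using bij by (auto simp: bij_betw_def intro: inj_on_subset)
    then show ?thesis
      using finite_cuts by (simp add: card_Diff_subset finite_subset card_image)
  qed
  ultimately show ?thesis
    using False dim_block_constant[of ?c "?pre ` ?Z"] by (simp add: face_dim_def)
qed

lemma face_number_crown:
  "face_number k (order_polytope (inv_image (crown_poset n) lab)) =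
    card (tight_pattern n ` {y. in_crown n y \<and> face_dim n y = k})"
proof -
  let ?H = "order_constraints (inv_image (crown_poset n) lab)"
  let ?X = "{x. in_crown n (coords lab x) \<and> face_dim n (coords lab x) = k}"
  have "{x \<in> polyhedron_of ?H. dim (tight_directions ?H x) = k} = ?X"
    using dim_tight_directions_crown
    by (auto simp flip: order_polytope_eq_polyhedron_of simp: order_polytope_crown_iff)
  then have "face_number k (order_polytope (inv_image (crown_poset n) lab)) = card (tight ?H ` ?X)"
    by (simp add: order_polytope_eq_polyhedron_of face_number_polyhedron_of finite_order_constraints)
  also have "\<dots> = card ((\<lambda>x. tight_pattern n (coords lab x)) ` ?X)"
    by (rule card_image_cong_kernel) (rule tight_crown_eq_iff)
  also have "(\<lambda>x. tight_pattern n (coords lab x)) ` ?X =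
      tight_pattern n ` {y. in_crown n y \<and> face_dim n y = k}" (is "?A = ?B")
  proof
    show "?B \<subseteq> ?A"
    proof
      fix p assume "p \<in> ?B"
      then obtain y where y: "in_crown n y" "face_dim n y = k" "p = tight_pattern n y" by blast
      define x :: "real ^ 'd" where "x = (\<chi> a. y (lab a))"
      have eq: "coords lab x v = y v" if "v \<in> {1..2*n}" for v
        unfolding x_def using coords_of_vec[OF that] .
      have eq': "coords lab x (next_vertex n v) = y (next_vertex n v)" if "v \<in> {1..2*n}" for v
        using eq[OF next_vertex_in[OF n that]] .
      have "1 \<in> {1..2*n}" using n by simp
      note eq1 = eq[OF this]
      have "cuts n (coords lab x) = cuts n y"
        unfolding cuts_def using eq eq' by auto
      moreover from this have "pinned n (coords lab x) = pinned n y"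
        unfolding pinned_def using eq cuts_subset[of n y] by auto
      moreover have "in_crown n (coords lab x) \<longleftrightarrow> in_crown n y"
        unfolding in_crown_def by (intro ball_cong refl) (simp only: eq eq')
      moreover have "{v\<in>{1..2*n}. coords lab x v = c} = {v\<in>{1..2*n}. y v = c}" for c
        using eq by auto
      ultimately have "x \<in> ?X" "p = tight_pattern n (coords lab x)"
        using y by (simp_all only: mem_Collect_eq face_dim_def tight_pattern_def eq1 simp_thms)
      then show "p \<in> ?A" by blast
    qed
  qed blast
  finally show ?thesis .
qed

end

section \<open>Counting the faces\<close>

text \<open>
  The constant labellings have three patterns, according to whether the constant is \<open>0\<close>, \<open>1\<close> or
  strictly in between.
\<close>

lemma tight_patterns_without_cuts:
  assumes "n \<ge> 1"
  shows "card (tight_pattern n ` {y. in_crown n y \<and> cuts n y = {} \<and> face_dim n y = k}) =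
    (if k = 0 then 2 else if k = 1 then 1 else 0)"
proof -
  let ?V = "{1..2*n}"
  let ?f = "\<lambda>c::real. ({}, if c = 0 then ?V else {}, if c = 1 then ?V else {}) :: nat set \<times> nat set \<times> nat set"
  let ?C = "{c::real. 0 \<le> c \<and> c \<le> 1 \<and> (if c = 0 \<or> c = 1 then 0 else 1) = k}"
  have V: "?V \<noteq> {}" using assms by simp
  have "tight_pattern n ` {y. in_crown n y \<and> cuts n y = {} \<and> face_dim n y = k} = ?f ` ?C" (is "?A = ?B")
  proof (intro equalityI subsetI)
    fix p assume "p \<in> ?A"
    then obtain y where y: "in_crown n y" "cuts n y = {}" "face_dim n y = k" "p = tight_pattern n y" by blast
    have "y v = c \<longleftrightarrow> y 1 = c" if "v \<in> ?V" for v c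
      by (simp only: constant_if_no_cuts[OF y(2) that])
    then have "{v \<in> ?V. y v = c} = (if y 1 = c then ?V else {})" for c
      by auto
    then have "p = ?f (y 1)"
      unfolding y(4) tight_pattern_def y(2) by simp
    moreover have "y 1 \<in> ?C"
      using y(1,2,3) assms by (auto simp: in_crown_def face_dim_def)
    ultimately show "p \<in> ?B" by blast
  next
    fix p assume "p \<in> ?B"
    then obtain c where c: "c \<in> ?C" "p = ?f c" by blast
    then have "in_crown n (\<lambda>_. c)" "cuts n (\<lambda>_. c) = {}" "face_dim n (\<lambda>_. c) = k"
      by (auto simp: in_crown_def cuts_def face_dim_def)
    moreover have "p = tight_pattern n (\<lambda>_. c)"
      using c(2) by (auto simp: tight_pattern_def cuts_def)
    ultimately show "p \<in> ?A" by blast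
  qed
  moreover have "card (?f ` ?C) = (if k = 0 then 2 else if k = 1 then 1 else 0)"
  proof -
    consider "k = 0" | "k = 1" | "k > 1" by linarith
    then show ?thesis
    proof cases
      case 1
      then have "?C = {0, 1}" by auto
      then show ?thesis using 1 V by auto
    next
      case 2
      then have "?C = {0<..<1}" by auto
      moreover have "?f ` {0<..<1} = {({}, {}, {})}"
      proof -
        have "?f ` {0<..<1} = (\<lambda>_. ({}, {}, {})) ` {0<..<1::real}"
          by (intro image_cong refl) simp
        then show ?thesis by (simp only: image_constant_conv) simp
      qed
      ultimately show ?thesis using 2 by simp
    next
      case 3
      then have "?C = {}" by auto
      then show ?thesis using 3 by simp
    qed
  qed
  ultimately show ?thesis by simp
qed

text \<open>
  The second component of a pair is the set of last vertices of the pinned arcs.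
\<close>

definition cut_pairs :: "nat \<Rightarrow> nat \<Rightarrow> (nat set \<times> nat set) set" where
  "cut_pairs n k = {(S, Z). S \<subseteq> {1..2*n} \<and> cyclic_changes S \<noteq> {} \<and> Z \<subseteq> cyclic_changes S \<and>
     card S - card Z = k}"

lemma tight_patterns_with_cuts:
  assumes "n \<ge> 1"
  shows "card (tight_pattern n ` {y. in_crown n y \<and> cuts n y \<noteq> {} \<and> face_dim n y = k}) =
    card (cut_pairs n k)"
proof -
  let ?Y = "{y. in_crown n y \<and> cuts n y \<noteq> {} \<and> face_dim n y = k}"
  have "card (tight_pattern n ` ?Y) = card ((\<lambda>y. (cuts n y, pinned n y)) ` ?Y)"
  proof (rule card_image_cong_kernel)
    fix y z assume yz: "y \<in> ?Y" "z \<in> ?Y"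
    have pin: "pinned n y = cuts n y \<inter> ({v\<in>{1..2*n}. y v = 0} \<union> {v\<in>{1..2*n}. y v = 1})" for y
      using cuts_subset[of n y] by (auto simp: pinned_def)
    have vals: "{v\<in>{1..2*n}. y v = 0} = {v\<in>{1..2*n}. z v = 0}"
        "{v\<in>{1..2*n}. y v = 1} = {v\<in>{1..2*n}. z v = 1}"
      if eq: "cuts n y = cuts n z" "pinned n y = pinned n z"
    proof -
      have "in_crown n y" "cuts n y \<noteq> {}" "in_crown n z" "cuts n z \<noteq> {}" using yz by auto
      note pinned_value[OF assms this(1,2)] pinned_value[OF assms this(3,4)]
      then have "y v = 0 \<longleftrightarrow> z v = 0" "y v = 1 \<longleftrightarrow> z v = 1" if "v \<in> {1..2*n}" for v
        using that by (simp_all only: eq)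
      then show "{v\<in>{1..2*n}. y v = 0} = {v\<in>{1..2*n}. z v = 0}"
        "{v\<in>{1..2*n}. y v = 1} = {v\<in>{1..2*n}. z v = 1}"
        by blast+
    qed
    show "tight_pattern n y = tight_pattern n z \<longleftrightarrow> (cuts n y, pinned n y) = (cuts n z, pinned n z)"
      unfolding tight_pattern_def prod.inject
    proof (intro iffI conjI; elim conjE)
      assume "cuts n y = cuts n z" "{v\<in>{1..2*n}. y v = 0} = {v\<in>{1..2*n}. z v = 0}"
        "{v\<in>{1..2*n}. y v = 1} = {v\<in>{1..2*n}. z v = 1}"
      then show "pinned n y = pinned n z" by (simp only: pin[of y] pin[of z])
    qed (use vals in blast)+
  qed
  also have "(\<lambda>y. (cuts n y, pinned n y)) ` ?Y = cut_pairs n k" (is "?A = _")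
  proof (intro equalityI subsetI)
    fix p assume "p \<in> ?A"
    then obtain y where y: "in_crown n y" "cuts n y \<noteq> {}" "face_dim n y = k" "p = (cuts n y, pinned n y)" by blast
    have "cyclic_changes (cuts n y) \<noteq> {}"
      using cyclic_changes_nonempty_iff[OF finite_cuts] cuts_both_parities[OF assms y(1,2)] by blast
    then show "p \<in> cut_pairs n k"
      using y cuts_subset pinned_subset_cyclic_changes[OF assms y(1)]
      by (simp add: cut_pairs_def face_dim_def)
  next
    fix p assume p: "p \<in> cut_pairs n k"
    obtain S Z where SZ: "p = (S, Z)" by fastforce
    then have *: "S \<subseteq> {1..2*n}" "cyclic_changes S \<noteq> {}" "Z \<subseteq> cyclic_changes S" "card S - card Z = k"
      using p by (auto simp: cut_pairs_def)
    from exists_labelling[OF assms *(1-3)]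
    obtain y where y: "in_crown n y" "cuts n y = S" "pinned n y = Z" by blast
    moreover have "S \<noteq> {}" using *(2) by (auto simp: cyclic_changes_def)
    ultimately have "y \<in> ?Y" using *(4) by (simp add: face_dim_def)
    then show "p \<in> ?A" using SZ y by blast
  qed
  finally show ?thesis .
qed

lemma card_tight_patterns:
  assumes "n \<ge> 1"
  shows "card (tight_pattern n ` {y. in_crown n y \<and> face_dim n y = k}) =
    (if k = 0 then 2 else if k = 1 then 1 else 0) + card (cut_pairs n k)"
proof -
  let ?Y0 = "{y. in_crown n y \<and> cuts n y = {} \<and> face_dim n y = k}"
  let ?Y1 = "{y. in_crown n y \<and> cuts n y \<noteq> {} \<and> face_dim n y = k}"
  have "{y. in_crown n y \<and> face_dim n y = k} = ?Y0 \<union> ?Y1" by blast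
  moreover have "tight_pattern n ` ?Y0 \<inter> tight_pattern n ` ?Y1 = {}"
    by (auto simp: tight_pattern_def)
  moreover have fin: "finite (tight_pattern n ` Y)" for Y
    by (rule finite_subset[of _ "Pow {1..2*n} \<times> Pow {1..2*n} \<times> Pow {1..2*n}"])
      (auto simp: tight_pattern_def cuts_def)
  ultimately show ?thesis
    by (simp only: image_Un card_Un_disjoint[OF fin fin] tight_patterns_without_cuts[OF assms]
        tight_patterns_with_cuts[OF assms])
qed

lemma card_cut_pairs:
  "card (cut_pairs n k) = (\<Sum>S | S \<subseteq> {1..2*n} \<and> cyclic_changes S \<noteq> {}.
     if k \<le> card S then card (cyclic_changes S) choose (card S - k) else 0)"
proof -
  let ?M = "{S. S \<subseteq> {1..2*n} \<and> cyclic_changes S \<noteq> {}}"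
  let ?Z = "\<lambda>S. {Z. Z \<subseteq> cyclic_changes S \<and> card S - card Z = k}"
  have fin: "finite S" "finite (cyclic_changes S)" "cyclic_changes S \<subseteq> S" if "S \<in> ?M" for S
    using that finite_subset[of S "{1..2*n}"] by (auto simp: cyclic_changes_def)
  have "cut_pairs n k = Sigma ?M ?Z"
    by (auto simp: cut_pairs_def)
  then have "card (cut_pairs n k) = (\<Sum>S\<in>?M. card (?Z S))"
    using fin(2) by (simp add: card_SigmaI)
  also have "\<dots> = (\<Sum>S\<in>?M. if k \<le> card S then card (cyclic_changes S) choose (card S - k) else 0)"
  proof (rule sum.cong[OF refl])
    fix S assume S: "S \<in> ?M"
    have le: "card Z \<le> card S" if "Z \<subseteq> cyclic_changes S" for Z
      using that fin[OF S] by (meson card_mono order_trans)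
    show "card (?Z S) = (if k \<le> card S then card (cyclic_changes S) choose (card S - k) else 0)"
    proof (cases "k \<le> card S")
      case True
      then have "?Z S = {Z. Z \<subseteq> cyclic_changes S \<and> card Z = card S - k}"
        using le by force
      then show ?thesis
        using n_subsets[OF fin(2)[OF S]] True by simp
    next
      case False
      then have empty: "?Z S = {}" by auto
      show ?thesis unfolding empty using False by simp
    qed
  qed
  finally show ?thesis .
qed

text \<open>
  The sets of cuts are grouped by the pair \<open>(i, m)\<close> for which they have \<open>i\<close> elements and \<open>2 * m\<close> cyclic
  changes.
\<close>

lemma real_card_cut_pairs:
  "real (card (cut_pairs n k)) =
    (\<Sum>i = 2..2*n. \<Sum>m = 1..i div 2.
       real (2*n) / real i * real (i choose (2*m)) * real ((n + m - 1) choose (i - 1)) *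
       (if k \<le> i then real ((2*m) choose (i - k)) else 0))"
proof -
  let ?M = "{S. S \<subseteq> {1..2*n} \<and> cyclic_changes S \<noteq> {}}"
  let ?T = "SIGMA i:{2..2*n}. {1..i div 2}"
  let ?G = "\<lambda>(i, m). if k \<le> i then real ((2*m) choose (i - k)) else 0"
  define g where "g S = (card S, card (cyclic_changes S) div 2)" for S :: "nat set"
  have finM: "finite ?M" by (rule finite_subset[of _ "Pow {1..2*n}"]) auto
  have M: "finite S" "S \<noteq> {}" "even (card (cyclic_changes S))" "card (cyclic_changes S) > 0"
      "card (cyclic_changes S) \<le> card S" if "S \<in> ?M" for S
  proof -
    show fS: "finite S" using that finite_subset[of S "{1..2*n}"] by simp
    show ne: "S \<noteq> {}" using that by (auto simp: cyclic_changes_def)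
    show "even (card (cyclic_changes S))"
      using card_cyclic_changes[OF fS ne] by simp
    have sub: "cyclic_changes S \<subseteq> S" by (auto simp: cyclic_changes_def)
    then show "card (cyclic_changes S) \<le> card S" using fS by (rule card_mono[rotated])
    show "card (cyclic_changes S) > 0"
      using that finite_subset[OF sub fS] by (simp add: card_gt_0_iff)
  qed
  have "g ` ?M \<subseteq> ?T"
  proof
    fix p assume "p \<in> g ` ?M"
    then obtain S where S: "S \<in> ?M" "p = g S" by blast
    have "card S \<le> 2*n"
      using S card_mono[of "{1..2*n}" S] by simp
    moreover have "card (cyclic_changes S) \<ge> 2"
      using M(3,4)[OF S(1)] by (auto elim!: evenE)
    ultimately show "p \<in> ?T"
      using M(5)[OF S(1)] S(2) by (auto simp: g_def div_le_mono)
  qed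
  have "real (card (cut_pairs n k)) = (\<Sum>S\<in>?M. ?G (g S))"
    unfolding card_cut_pairs of_nat_sum
    by (rule sum.cong[OF refl]) (use M(3) in \<open>simp add: g_def\<close>)
  also have "\<dots> = (\<Sum>p\<in>?T. \<Sum>S\<in>{S\<in>?M. g S = p}. ?G (g S))"
    by (rule sum.group[symmetric, OF finM _ \<open>g ` ?M \<subseteq> ?T\<close>]) simp
  also have "\<dots> = (\<Sum>p\<in>?T. real (card {S\<in>?M. g S = p}) * ?G p)"
    by (rule sum.cong[OF refl]) simp
  also have "\<dots> = (\<Sum>i = 2..2*n. \<Sum>m = 1..i div 2. real (card {S\<in>?M. g S = (i, m)}) * ?G (i, m))"
    by (subst sum.Sigma) (simp, simp, rule sum.cong[OF refl], auto)
  also have "\<dots> = (\<Sum>i = 2..2*n. \<Sum>m = 1..i div 2.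
       real (2*n) / real i * real (i choose (2*m)) * real ((n + m - 1) choose (i - 1)) *
       (if k \<le> i then real ((2*m) choose (i - k)) else 0))"
  proof (intro sum.cong[OF refl])
    fix i m assume im: "i \<in> {2..2*n}" "m \<in> {1..i div 2}"
    have "{S\<in>?M. g S = (i, m)} =
        {S. S \<subseteq> {1..2*n} \<and> card S = i \<and> card (cyclic_changes S) = 2*m}" (is "?A = ?B")
    proof (intro equalityI subsetI)
      fix S assume "S \<in> ?A"
      then show "S \<in> ?B" using M(3)[of S] by (auto simp: g_def)
    next
      fix S assume "S \<in> ?B"
      then show "S \<in> ?A" using im by (auto simp: g_def)
    qed
    moreover have "2 \<le> i" "1 \<le> m" "i \<le> 2*n" "2*m \<le> i" using im by auto
    ultimately show "real (card {S\<in>?M. g S = (i, m)}) * ?G (i, m) =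
       real (2*n) / real i * real (i choose (2*m)) * real ((n + m - 1) choose (i - 1)) *
       (if k \<le> i then real ((2*m) choose (i - k)) else 0)"
      by (simp only: card_sets_with_cyclic_changes prod.case)
  qed
  finally show ?thesis .
qed

theorem theorem3p6:
  fixes n k :: nat and lab :: "'d::finite \<Rightarrow> nat"
  assumes "n \<ge> 1"
    and "bij_betw lab UNIV {1..2*n}"
  shows "real (face_number k (order_polytope (inv_image (crown_poset n) lab) :: (real ^ 'd) set)) =
    (if k = 0 then 2 else if k = 1 then 1 else 0) +
    (\<Sum>i = 2..2*n. \<Sum>m = 1..i div 2.
       real (2*n) / real i * real (i choose (2*m)) * real ((n + m - 1) choose (i - 1)) *
       (if k \<le> i then real ((2*m) choose (i - k)) else 0))"
  using face_number_crown[OF assms, of k] card_tight_patterns[OF assms(1), of k] real_card_cut_pairs[of n k]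
  by simp

end
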